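(* Let $\mathbb{F}$ be a finite field of order $q$, let $0\le n\le m$ be integers, and let $\theta$ be a non-trivial additive character of $\mathbb{F}$. Let $\varPhi_{n,m}$ be the canonical matrix of the pair $(\operatorname{Mat}_{n,m}(\mathbb{F}),\operatorname{GL}_n(\mathbb{F})\times\operatorname{GL}_m(\mathbb{F}))$. Then for all $s,r\in\{0,1,\dots,n\}$, $$\varPhi_{n,m}(s,r)=(-1)^rq^{\binom r2}(q^m;q^{-1})_r\begin{bmatrix} n \\ r \end{bmatrix}_q K^{\mathrm{Aff}}_s(r;q^{-m},n;q),$$ where $K^{\mathrm{Aff}}$ denotes the Affine $q$-Krawtchouk polynomial.
   Context: $\operatorname{Mat}_{n,m}(\mathbb{F})$ is the additive group of $n\times m$ matrices over $\mathbb{F}$ (zero if $n=0$, with $\varPhi_{0,m}(0,0)=1$). The group $\operatorname{GL}_n(\mathbb{F})\times\operatorname{GL}_m(\mathbb{F})$ acts by $\rho(g,h)a=ga\,{}^th$; its orbits are the sets of matrices of rank $r$, $0\le r\le n$. With $\langle a|b\rangle=\operatorname{trace}({}^tab)$ and $\theta_a(b)=\theta(\langle a|b\rangle)$, the orbits on the character group are $\{\theta_a:\operatorname{rank}a=s\}$, $0\le s\le n$. The canonical matrix is $$\varPhi_{n,m}(s,r)=\sum_{b\in\operatorname{Mat}_{n,m}(\mathbb{F}),\ \operatorname{rank}b=r}\overline{\theta(\langle a|b\rangle)},\qquad a\text{ any matrix with }\operatorname{rank}a=s$$ (independent of the choice of $a$). Notation: $(a;q)_k=(1-a)(1-aq)\cdots(1-aq^{k-1})$,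 $(a;q)_0=1$ (so $(q^m;q^{-1})_r=\prod_{i=0}^{r-1}(1-q^{m-i})$); Gaussian polynomial $\begin{bmatrix} N \\ x \end{bmatrix}_q=\dfrac{(q^N;q^{-1})_x}{(q;q)_x}$. Affine $q$-Krawtchouk polynomial: for integers $0\le y\le N$, $$K^{\mathrm{Aff}}_y(x;a,N;q)=\sum_{k=0}^{y}\frac{(q^{-y};q)_k\,(q^{-x};q)_k}{(q^{-N};q)_k\,(a;q)_k\,(q;q)_k}\,q^k.$$ *)

theory Defs
  imports Complex_Main "Jordan_Normal_Form.DL_Rank"
begin

text \<open>Matrices over a finite field are those of \<^theory>\<open>Jordan_Normal_Form.Matrix\<close>, whose
  dimensions are natural numbers; \<open>carrier_mat 0 m\<close> is a singleton, i.e. the trivial group.\<close>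

abbreviation mat_rank :: "'a::field mat \<Rightarrow> nat" where
  "mat_rank A \<equiv> vec_space.rank (dim_row A) A"

definition mat_trace :: "'a::comm_monoid_add mat \<Rightarrow> 'a" where
  "mat_trace A = (\<Sum>i<dim_row A. A $$ (i, i))"

definition mat_pairing :: "'a::comm_semiring_0 mat \<Rightarrow> 'a mat \<Rightarrow> 'a" where
  "mat_pairing A B = mat_trace (transpose_mat A * B)"

definition additive_character :: "('a::ab_group_add \<Rightarrow> complex) \<Rightarrow> bool" where
  "additive_character \<theta> \<longleftrightarrow> (\<forall>x. cmod (\<theta> x) = 1) \<and> (\<forall>x y. \<theta> (x + y) = \<theta> x * \<theta> y)"

definition nontrivial_additive_character :: "('a::ab_group_add \<Rightarrow> complex) \<Rightarrow> bool" where
  "nontrivial_additive_character \<theta> \<longleftrightarrow> additive_character \<theta> \<and> (\<exists>x. \<theta> x \<noteq> 1)"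

text \<open>The orbits of \<open>GL\<^sub>n \<times> GL\<^sub>m\<close> on \<open>n \<times> m\<close> matrices are the sets of matrices of a fixed rank, so
  the canonical matrix is indexed by ranks.  Its entry at \<open>(s, r)\<close> is the common value of the
  character sum over the matrices of rank \<open>r\<close>, for all matrices \<open>a\<close> of rank \<open>s\<close>; the description is
  proper only because the sum does not depend on the choice of \<open>a\<close> (and for \<open>s \<le> min n m\<close>, where
  such an \<open>a\<close> exists).\<close>

definition canonical_matrix ::
  "('a::{field, finite} \<Rightarrow> complex) \<Rightarrow> nat \<Rightarrow> nat \<Rightarrow> nat \<Rightarrow> nat \<Rightarrow> complex" where
  "canonical_matrix \<theta> n m s r =
     (THE z. \<forall>a \<in> carrier_mat n m. mat_rank a = s \<longrightarrow>
        z = (\<Sum>b \<in> {b \<in> carrier_mat n m. mat_rank b = r}. cnj (\<theta> (mat_pairing a b))))"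

definition qpoch :: "'a::comm_ring_1 \<Rightarrow> 'a \<Rightarrow> nat \<Rightarrow> 'a" where
  "qpoch a q k = (\<Prod>i<k. 1 - a * q ^ i)"

definition gauss_poly :: "'a::field \<Rightarrow> nat \<Rightarrow> nat \<Rightarrow> 'a" where
  "gauss_poly q N x = qpoch (q ^ N) (inverse q) x / qpoch q q x"

text \<open>\<open>aff_q_krawtchouk y x a N q\<close> is \<open>K\<^sup>A\<^sup>f\<^sup>f\<^sub>y(x; a, N; q)\<close>, meaningful for \<open>y \<le> N\<close>.\<close>

definition aff_q_krawtchouk :: "nat \<Rightarrow> nat \<Rightarrow> 'a::field \<Rightarrow> nat \<Rightarrow> 'a \<Rightarrow> 'a" where
  "aff_q_krawtchouk y x a N q =
     (\<Sum>k\<le>y. (qpoch (q powi (- int y)) q k * qpoch (q powi (- int x)) q k) /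
             (qpoch (q powi (- int N)) q k * qpoch a q k * qpoch q q k) * q ^ k)"

end

theory Submission
  imports Defs "Jordan_Normal_Form.Column_Operations"
begin

text \<open>Any matrix \<open>a\<close> of rank \<open>s + 1\<close> is equivalent to a block matrix with diagonal blocks \<open>a'\<close> of rank
  \<open>s\<close> and a single non-zero corner entry.  Summing over the last column \<open>c\<close> of \<open>b = (b' | c)\<close> first,
  where \<open>c\<close> lies inside or outside the column space of \<open>b'\<close>, orthogonality of characters kills every
  \<open>b'\<close> whose last row is non-zero and leaves
  \<open>\<Phi>\<^sub>n\<^sub>,\<^sub>m (s + 1, r + 1) = q\<^sup>r\<^sup>+\<^sup>1 \<Phi>\<^sub>n\<^sub>-\<^sub>1\<^sub>,\<^sub>m\<^sub>-\<^sub>1 (s, r + 1) - q\<^sup>r \<Phi>\<^sub>n\<^sub>-\<^sub>1\<^sub>,\<^sub>m\<^sub>-\<^sub>1 (s, r)\<close>.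
  For \<open>s = 0\<close> the sum counts the matrices of rank \<open>r\<close>.  The right-hand side of the theorem satisfies the
  same recurrence: this follows by induction on \<open>s\<close> from the contiguous relation
  \<open>R\<^sub>n\<^sub>,\<^sub>m (s + 1, r + 1) = R\<^sub>n\<^sub>,\<^sub>m (s, r + 1) - q\<^sup>n\<^sup>+\<^sup>m\<^sup>-\<^sup>s\<^sup>-\<^sup>1 R\<^sub>n\<^sub>-\<^sub>1\<^sub>,\<^sub>m\<^sub>-\<^sub>1 (s, r)\<close>, which is read off termwise from the
  \<open>q\<close>-hypergeometric sum.\<close>

subsection \<open>The affine \<open>q\<close>-Krawtchouk side\<close>

lemma qpoch_0 [simp]: "qpoch a q 0 = 1"
  by (simp add: qpoch_def)

lemma qpoch_Suc: "qpoch a q (Suc k) = qpoch a q k * (1 - a * q ^ k)"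
  by (simp add: qpoch_def)

lemma qpoch_Suc_shift: "qpoch a q (Suc k) = (1 - a) * qpoch (a * q) q k"
  by (simp add: qpoch_def prod.lessThan_Suc_shift mult.assoc del: prod.lessThan_Suc)

text \<open>Multiplying \<open>inverse (q ^ Suc y)\<close> by \<open>q\<close> gives
  \<open>inverse (q ^ y)\<close>, so splitting off the first factor lowers the parameter by one.
  This turns terms at sizes n + 1, m + 1 into terms at sizes n, m.\<close>

lemma qpoch_inverse_power_Suc:
  fixes q :: "'a::field"
  assumes "q \<noteq> 0"
  shows "qpoch (inverse (q ^ Suc y)) q (Suc k) = (1 - inverse (q ^ Suc y)) * qpoch (inverse (q ^ y)) q k"
  using assms by (simp add: qpoch_Suc_shift field_simps)

lemma qpoch_power_Suc:
  fixes q :: "'a::field"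
  assumes "q \<noteq> 0"
  shows "qpoch (q ^ Suc N) (inverse q) (Suc k) = (1 - q ^ Suc N) * qpoch (q ^ N) (inverse q) k"
  using assms by (simp add: qpoch_Suc_shift field_simps)

text \<open>For \<open>q\<close> the order of a finite field this is the number of n by m matrices
  of rank r, as \<open>rank_sum_zero_mat\<close> shows.\<close>

definition rank_count :: "'a::field \<Rightarrow> nat \<Rightarrow> nat \<Rightarrow> nat \<Rightarrow> 'a" where
  "rank_count q n m r =
     (- 1) ^ r * q ^ (r choose 2) * qpoch (q ^ m) (inverse q) r * gauss_poly q n r"

definition rank_char_sum :: "'a::field \<Rightarrow> nat \<Rightarrow> nat \<Rightarrow> nat \<Rightarrow> nat \<Rightarrow> 'a" where
  "rank_char_sum q n m s r = rank_count q n m r * aff_q_krawtchouk s r (q powi (- int m)) n q"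

lemma rank_count_0 [simp]: "rank_count q n m 0 = 1"
  by (simp add: rank_count_def gauss_poly_def numeral_2_eq_2)

lemma choose_two_Suc: "Suc r choose 2 = (r choose 2) + r"
  by (simp add: numeral_2_eq_2)

text \<open>These assumptions keep the denominators of the hypergeometric sums away from zero: up to
  powers of q, each factor of (q; q)_k, and of (q^(-y); q)_k with k \<le> y, has the form 1 - q^i
  with i > 0.\<close>

locale non_root_of_unity =
  fixes q :: "'a::field"
  assumes q_nz: "q \<noteq> 0" and power_neq_1: "0 < k \<Longrightarrow> q ^ k \<noteq> 1"
begin

lemma qpoch_q_nz: "qpoch q q k \<noteq> 0"
proof -
  have "1 - q * q ^ i \<noteq> 0" for i
    using power_neq_1[of "Suc i"] by simp
  then show ?thesis by (simp add: qpoch_def)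
qed

lemma qpoch_inverse_nz: "k \<le> y \<Longrightarrow> qpoch (inverse (q ^ y)) q k \<noteq> 0"
proof -
  assume "k \<le> y"
  have "1 - inverse (q ^ y) * q ^ i \<noteq> 0" if "i < k" for i
  proof -
    have "q ^ y = q ^ (y - i) * q ^ i"
      using \<open>i < k\<close> \<open>k \<le> y\<close> by (simp flip: power_add)
    then show ?thesis
      using power_neq_1[of "y - i"] q_nz \<open>i < k\<close> \<open>k \<le> y\<close> by (auto simp: field_simps)
  qed
  then show ?thesis by (simp add: qpoch_def)
qed

text \<open>In counting terms, a matrix of rank r + 1 keeps its rank when one of the q^(r+1) vectors
  of its column space is appended, and a matrix of rank r gains rank from the other q^n - q^r
  columns. Here it is a rational identity: all three terms are multiples of
  \<open>X\<close>.\<close>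

lemma rank_count_Suc_right:
  "rank_count q n (Suc m) (Suc r) =
     q ^ Suc r * rank_count q n m (Suc r) + (q ^ n - q ^ r) * rank_count q n m r"
proof -
  have nz: "1 - q ^ Suc r \<noteq> 0" "qpoch q q r \<noteq> 0" "q ^ r \<noteq> 0"
    using power_neq_1[of "Suc r"] qpoch_q_nz q_nz by auto
  define X where "X = (- 1) ^ r * q ^ (r choose 2) * qpoch (q ^ m) (inverse q) r *
      (qpoch (q ^ n) (inverse q) r / qpoch q q r)"
  have r: "rank_count q n m r = X"
    by (simp add: rank_count_def gauss_poly_def X_def)
  have 1: "rank_count q n m (Suc r) =
      - (q ^ r) * (1 - q ^ m / q ^ r) * (1 - q ^ n / q ^ r) / (1 - q ^ Suc r) * X"
    using nz q_nz by (simp add: rank_count_def gauss_poly_def X_def choose_two_Suc power_add qpoch_Suc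
        power_inverse field_simps)
  have 2: "rank_count q n (Suc m) (Suc r) =
      - (q ^ r) * (1 - q ^ Suc m) * (1 - q ^ n / q ^ r) / (1 - q ^ Suc r) * X"
    unfolding rank_count_def gauss_poly_def qpoch_power_Suc[OF q_nz]
    using nz q_nz by (simp add: X_def choose_two_Suc power_add qpoch_Suc power_inverse field_simps)
  show ?thesis
  proof -
    \<comment> \<open>\<open>R\<close>, \<open>M\<close>, \<open>N\<close>, \<open>e\<close> stand
      for q^r, q^m, q^n and 1 - q^(r+1). Both sides are (R - N) X / e times a cofactor, and the
      cofactors agree because q R = 1 - e.\<close>
    have gen: "- R * (1 - q * M) * (1 - N / R) / e * X =
        q * R * (- R * (1 - M / R) * (1 - N / R) / e * X) + (N - R) * X"
      if "e \<noteq> 0" "R \<noteq> 0" "q * R = 1 - e" for e R M N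
    proof -
      have gen: "- R * (1 - q * M) * (1 - N / R) / e * X = (R - N) * X / e * (q * M - 1)"
        using that(2) by (simp add: divide_simps) (simp add: algebra_simps)
      moreover have "q * R * (- R * (1 - M / R) * (1 - N / R) / e * X) + (N - R) * X =
          (R - N) * X / e * (q * M - q * R - e)"
        using that(1,2) by (simp add: divide_simps) (simp add: algebra_simps)
      ultimately show ?thesis
        using that(3) by simp
    qed
    show ?thesis
      unfolding r 1 2 power_Suc by (rule gen) (use nz in simp_all)
  qed
qed

lemma rank_count_Suc_Suc:
  "rank_count q (Suc n) (Suc m) (Suc r) =
     - (q ^ r) * (1 - q ^ Suc m) * (1 - q ^ Suc n) / (1 - q ^ Suc r) * rank_count q n m r"
  unfolding rank_count_def gauss_poly_def qpoch_power_Suc[OF q_nz]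
  using power_neq_1[of "Suc r"] qpoch_q_nz[of r]
  by (simp add: choose_two_Suc power_add qpoch_Suc field_simps)

text \<open>This is the case s = 0 of \<open>rank_char_sum_recurrence\<close>: by
  \<open>rank_char_sum_Suc\<close> the left-hand side is the entry at s = 1.\<close>

lemma rank_count_Suc_Suc_diff:
  "rank_count q (Suc n) (Suc m) (Suc r) - q ^ (n + m + 1) * rank_count q n m r =
     q ^ Suc r * rank_count q n m (Suc r) - q ^ r * rank_count q n m r"
proof -
  have nz: "1 - q ^ Suc r \<noteq> 0" "qpoch q q r \<noteq> 0" "q ^ r \<noteq> 0"
    using power_neq_1[of "Suc r"] qpoch_q_nz q_nz by auto
  have 1: "rank_count q n m (Suc r) =
      - (q ^ r) * (1 - q ^ m / q ^ r) * (1 - q ^ n / q ^ r) / (1 - q ^ Suc r) * rank_count q n m r"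
    using nz q_nz by (simp add: rank_count_def gauss_poly_def choose_two_Suc power_add qpoch_Suc
        power_inverse field_simps)
  show ?thesis
  proof -
    have gen: "- R * (1 - q * M) * (1 - q * N) / e * X - q * N * M * X =
        q * R * (- R * (1 - M / R) * (1 - N / R) / e * X) - R * X"
      if "e \<noteq> 0" "R \<noteq> 0" "e = 1 - q * R" for e R M N X
    proof -
      have gen: "- R * (1 - q * M) * (1 - q * N) / e * X - q * N * M * X =
          - X / e * (R * (1 - q * M) * (1 - q * N) + q * N * M * e)"
        using that(1) by (simp add: divide_simps) (simp add: algebra_simps)
      moreover have "q * R * (- R * (1 - M / R) * (1 - N / R) / e * X) - R * X =
          - X / e * (q * (R - M) * (R - N) + R * e)"
        using that(1,2) by (simp add: divide_simps) (simp add: algebra_simps)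
      ultimately show ?thesis
        by (simp only: that(3)) (simp add: algebra_simps)
    qed
    have pq: "q ^ (n + m + 1) = q * q ^ n * q ^ m"
      by (simp add: power_add)
    show ?thesis
      unfolding 1 rank_count_Suc_Suc pq power_Suc by (rule gen) (use nz in simp_all)
  qed
qed

text \<open>The two sums on sizes n + 1, m + 1 differ only in the symbols (q^(-s-1); q)_k and
  (q^(-s); q)_k. Their difference vanishes at k = 0; after the shift of k by one, every other
  parameter loses its first factor, so r, n and m all drop by one.\<close>

lemma krawtchouk_Suc:
  assumes "s \<le> n" "s \<le> m"
  shows "aff_q_krawtchouk (Suc s) (Suc r) (q powi (- int (Suc m))) (Suc n) q =
     aff_q_krawtchouk s (Suc r) (q powi (- int (Suc m))) (Suc n) q
     - (1 - inverse (q ^ Suc r)) / (q ^ s * (1 - inverse (q ^ Suc n)) * (1 - inverse (q ^ Suc m)))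
       * aff_q_krawtchouk s r (q powi (- int m)) n q"
proof -
  define w where "w y k = qpoch (inverse (q ^ y)) q k" for y k
  define d where "d k = w (Suc n) k * w (Suc m) k * qpoch q q k" for k
  have wSuc: "w (Suc y) (Suc k) = (1 - inverse (q ^ Suc y)) * w y k" for y k
    unfolding w_def by (rule qpoch_inverse_power_Suc[OF q_nz])
  have K: "aff_q_krawtchouk y x (q powi (- int M)) N q =
      (\<Sum>k\<le>y. w y k * w x k / (w N k * w M k * qpoch q q k) * q ^ k)" for y x M N
    by (simp add: aff_q_krawtchouk_def w_def power_int_minus)
  \<comment> \<open>The last factor 1 - q^(-s) q^s is zero, so the sum of degree s may run up to
    \<open>Suc s\<close> and be subtracted termwise.\<close>
  have "w s (Suc s) = 0"
    using q_nz by (simp add: w_def qpoch_Suc)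
  then have ext: "aff_q_krawtchouk s (Suc r) (q powi (- int (Suc m))) (Suc n) q =
      (\<Sum>k\<le>Suc s. w s k * w (Suc r) k / d k * q ^ k)"
    unfolding K d_def by simp
  have nz1: "1 - inverse (q ^ Suc y) \<noteq> 0" for y
    using power_neq_1[of "Suc y"] q_nz by (auto simp: field_simps)
  have step: "(w (Suc s) (Suc k) - w s (Suc k)) * w (Suc r) (Suc k) / d (Suc k) * q ^ Suc k =
      - (1 - inverse (q ^ Suc r)) / (q ^ s * (1 - inverse (q ^ Suc n)) * (1 - inverse (q ^ Suc m)))
       * (w s k * w r k / (w n k * w m k * qpoch q q k) * q ^ k)" if "k \<le> s" for k
  proof -
    have nz: "w n k \<noteq> 0" "w m k \<noteq> 0" "qpoch q q k \<noteq> 0"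
      using that assms by (auto simp: w_def qpoch_inverse_nz qpoch_q_nz)
    have nz2: "1 - q * q ^ k \<noteq> 0"
      using power_neq_1[of "Suc k"] by simp
    \<comment> \<open>Both symbols contain \<open>w s k\<close>; the first is split at its first
      factor, the second at its last. The resulting 1 - q^(k+1) cancels the last factor of (q;
      q)_(k+1) in \<open>d (Suc k)\<close>.\<close>
    have a: "w (Suc s) (Suc k) - w s (Suc k) = - w s k * (1 - q * q ^ k) / q ^ Suc s"
      unfolding wSuc using q_nz by (simp add: w_def qpoch_Suc field_simps)
    have b: "d (Suc k) = (1 - inverse (q ^ Suc n)) * (1 - inverse (q ^ Suc m))
        * (w n k * w m k * qpoch q q k) * (1 - q * q ^ k)"
      unfolding d_def wSuc by (simp add: qpoch_Suc)
    have "(- u * e / (q * S)) * (v * x) / (a * b * D * e) * (q * Q) = - v / (S * a * b) * (u * x / D * Q)"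
      if "e \<noteq> 0" for u v x e a b D S Q
      using that q_nz by (cases "a = 0 \<or> b = 0 \<or> D = 0 \<or> S = 0") (auto simp: divide_simps)
    note step = this[OF nz2]
    show ?thesis
      unfolding a b wSuc[of r] unfolding power_Suc by (rule step)
  qed
  have "aff_q_krawtchouk (Suc s) (Suc r) (q powi (- int (Suc m))) (Suc n) q -
      aff_q_krawtchouk s (Suc r) (q powi (- int (Suc m))) (Suc n) q =
      (\<Sum>k\<le>Suc s. (w (Suc s) k - w s k) * w (Suc r) k / d k * q ^ k)"
    unfolding ext K[of "Suc s"] d_def[symmetric] sum_subtractf[symmetric]
    by (simp add: algebra_simps diff_divide_distrib)
  also have "\<dots> = (\<Sum>k\<le>s. (w (Suc s) (Suc k) - w s (Suc k)) * w (Suc r) (Suc k) / d (Suc k) * q ^ Suc k)"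
    by (subst sum.atMost_Suc_shift) (simp add: w_def)
  also have "\<dots> = - (1 - inverse (q ^ Suc r)) / (q ^ s * (1 - inverse (q ^ Suc n)) * (1 - inverse (q ^ Suc m)))
       * aff_q_krawtchouk s r (q powi (- int m)) n q"
    unfolding K sum_distrib_left using step by (intro sum.cong) auto
  finally show ?thesis
    unfolding minus_divide_left[symmetric] mult_minus_left
    by (simp only: diff_eq_eq uminus_add_conv_diff diff_add_cancel)
qed

text \<open>Multiply \<open>krawtchouk_Suc\<close> by the rank count at size n + 1, m + 1. By
  \<open>rank_count_Suc_Suc\<close> the coefficient cancels against the first factors of the count
  and only a power of q remains.\<close>

lemma rank_char_sum_Suc:
  assumes "s \<le> n" "s \<le> m"
  shows "rank_char_sum q (Suc n) (Suc m) (Suc s) (Suc r) =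
     rank_char_sum q (Suc n) (Suc m) s (Suc r) - q ^ (n + m + 1) / q ^ s * rank_char_sum q n m s r"
proof -
  have nz: "1 - q ^ Suc y \<noteq> 0" "1 - inverse (q ^ Suc y) \<noteq> 0" for y
    using power_neq_1[of "Suc y"] q_nz by (auto simp: field_simps)
  have inv: "1 - inverse (q ^ Suc y) = - (1 - q ^ Suc y) / q ^ Suc y" for y
    using q_nz by (simp add: field_simps)
  have "- (q ^ r) * (1 - q ^ Suc m) * (1 - q ^ Suc n) / (1 - q ^ Suc r) *
     ((1 - inverse (q ^ Suc r)) / (q ^ s * (1 - inverse (q ^ Suc n)) * (1 - inverse (q ^ Suc m)))) =
     q ^ (n + m + 1) / q ^ s"
  proof -
    have gen: "- R * M * N / X * ((- X / (q * R)) / (S * (- N / (q * A)) * (- M / (q * B)))) = q * A * B * q / (S * q)"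
      if "M \<noteq> 0" "N \<noteq> 0" "X \<noteq> 0" "R \<noteq> 0" "A \<noteq> 0" "B \<noteq> 0" "S \<noteq> 0" for R M N X S A B
      using that q_nz by (simp add: divide_simps)
    have pq: "q ^ (n + m + 1) / q ^ s = q * q ^ n * q ^ m * q / (q ^ s * q)"
      using q_nz by (simp add: power_add)
    show ?thesis
      unfolding inv unfolding pq power_Suc
      by (rule gen) (use nz(1)[of r] nz(1)[of n] nz(1)[of m] q_nz in \<open>simp_all only: power_Suc power_not_zero not_False_eq_True\<close>)
  qed
  then have *: "rank_count q (Suc n) (Suc m) (Suc r) *
     ((1 - inverse (q ^ Suc r)) / (q ^ s * (1 - inverse (q ^ Suc n)) * (1 - inverse (q ^ Suc m)))) =
     q ^ (n + m + 1) / q ^ s * rank_count q n m r"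
    unfolding rank_count_Suc_Suc by (simp only: mult.commute mult.left_commute)
  show ?thesis
    unfolding rank_char_sum_def krawtchouk_Suc[OF assms]
      right_diff_distrib[of "rank_count q (Suc n) (Suc m) (Suc r)"]
    by (simp only: mult.assoc[symmetric] *)
qed

section \<open>The joint recurrence of the right-hand side in n and m\<close>

lemma rank_char_sum_0_right [simp]: "rank_char_sum q n m s 0 = 1"
proof -
  \<comment> \<open>The symbol (1; q)_k is zero for k > 0, so only the term k = 0 survives.\<close>
  have "aff_q_krawtchouk s 0 (q powi (- int m)) n q = 1"
    unfolding aff_q_krawtchouk_def
    by (subst sum.atMost_shift) (simp add: qpoch_Suc_shift)
  then show ?thesis by (simp add: rank_char_sum_def)
qed

lemma rank_char_sum_0_left: "rank_char_sum q n m 0 r = rank_count q n m r"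
  by (simp add: rank_char_sum_def aff_q_krawtchouk_def)

text \<open>The contiguous relation at sizes n + 1, m + 1 lowers s; the induction hypothesis
  rewrites both resulting terms, and the contiguous relation at sizes n, m reassembles them at the
  higher s.\<close>

lemma rank_char_sum_recurrence:
  assumes "s \<le> n" "s \<le> m"
  shows "rank_char_sum q (Suc n) (Suc m) (Suc s) (Suc r) =
     q ^ Suc r * rank_char_sum q n m s (Suc r) - q ^ r * rank_char_sum q n m s r"
  using assms
proof (induction s arbitrary: n m r)
  case 0
  then show ?case
    using rank_count_Suc_Suc_diff[of n m r]
    by (simp add: rank_char_sum_Suc rank_char_sum_0_left)
next
  case (Suc s)
  then obtain n' m' where nm: "n = Suc n'" "m = Suc m'" "s \<le> n'" "s \<le> m'"
    by (metis Suc_le_D Suc_le_mono)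
  have IH: "rank_char_sum q (Suc n) (Suc m) (Suc s) (Suc r) =
     q ^ Suc r * rank_char_sum q n m s (Suc r) - q ^ r * rank_char_sum q n m s r" for r
    using Suc by simp
  have IH': "rank_char_sum q n m (Suc s) (Suc r) =
     q ^ Suc r * rank_char_sum q n' m' s (Suc r) - q ^ r * rank_char_sum q n' m' s r" for r
    using Suc.IH nm by simp
  have star: "rank_char_sum q (Suc n) (Suc m) (Suc (Suc s)) (Suc r) =
     rank_char_sum q (Suc n) (Suc m) (Suc s) (Suc r)
     - q ^ (n + m + 1) / q ^ Suc s * rank_char_sum q n m (Suc s) r"
    using Suc.prems by (rule rank_char_sum_Suc)
  have star': "rank_char_sum q n m (Suc s) (Suc r) =
     rank_char_sum q n m s (Suc r) - q ^ (n' + m' + 1) / q ^ s * rank_char_sum q n' m' s r" for r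
    unfolding nm(1,2) using nm(3,4) by (rule rank_char_sum_Suc)
  show ?case
  \<comment> \<open>The contiguous relation needs a positive second index, so r = 0 is separate;
    there all entries with second index 0 equal 1.\<close>
  proof (cases r)
    case 0
    show ?thesis
      unfolding star unfolding IH 0 star' using q_nz by (simp add: nm field_simps)
  next
    case (Suc r')
    \<comment> \<open>The surplus factor q makes up for replacing q^(r+1), q^r by q^r, q^(r-1) when
      the second index drops.\<close>
    have e: "q ^ (n + m + 1) / q ^ Suc s = q * (q ^ (n' + m' + 1) / q ^ s)"
      using q_nz by (simp add: nm field_simps)
    have "q ^ Suc r * rank_char_sum q n m (Suc s) (Suc r) - q ^ r * rank_char_sum q n m (Suc s) r =
        q ^ Suc r * rank_char_sum q n m s (Suc r) - q ^ r * rank_char_sum q n m s r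
        - q * (q ^ (n' + m' + 1) / q ^ s)
          * (q ^ Suc r' * rank_char_sum q n' m' s (Suc r') - q ^ r' * rank_char_sum q n' m' s r')"
      unfolding Suc star' by (simp add: algebra_simps)
    then show ?thesis
      unfolding star unfolding IH e unfolding Suc IH' by simp
  qed
qed

end

subsection \<open>Rank and column space\<close>

text \<open>The column space as an image set: over a finite field its cardinality determines the
  rank, and images are easy to count.\<close>

definition mat_range :: "'a::field mat \<Rightarrow> 'a vec set" where
  "mat_range A = (\<lambda>x. A *\<^sub>v x) ` carrier_vec (dim_col A)"

definition snoc_col :: "'a mat \<Rightarrow> 'a vec \<Rightarrow> 'a mat" where
  "snoc_col A c = mat (dim_row A) (Suc (dim_col A))
     (\<lambda>(i, j). if j < dim_col A then A $$ (i, j) else c $ i)"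

definition snoc_zero_row :: "'a::zero mat \<Rightarrow> 'a mat" where
  "snoc_zero_row A = mat (Suc (dim_row A)) (dim_col A)
     (\<lambda>(i, j). if i < dim_row A then A $$ (i, j) else 0)"

lemma dim_snoc_col [simp]:
  "dim_row (snoc_col A c) = dim_row A" "dim_col (snoc_col A c) = Suc (dim_col A)"
  by (simp_all add: snoc_col_def)

lemma snoc_col_carrier [simp]: "snoc_col A c \<in> carrier_mat n (Suc m) \<longleftrightarrow> A \<in> carrier_mat n m"
  unfolding carrier_mat_def by simp

lemma dim_snoc_zero_row [simp]:
  "dim_row (snoc_zero_row A) = Suc (dim_row A)" "dim_col (snoc_zero_row A) = dim_col A"
  by (simp_all add: snoc_zero_row_def)

lemma snoc_zero_row_carrier [simp]: "snoc_zero_row A \<in> carrier_mat (Suc n) m \<longleftrightarrow> A \<in> carrier_mat n m"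
  unfolding carrier_mat_def by simp

lemma snoc_col_cases:
  assumes "B \<in> carrier_mat n (Suc m)"
  obtains A c where "A \<in> carrier_mat n m" "c \<in> carrier_vec n" "B = snoc_col A c"
proof
  show "mat n m (\<lambda>ij. B $$ ij) \<in> carrier_mat n m" by simp
  show "col B m \<in> carrier_vec n" using assms by auto
  show "B = snoc_col (mat n m (\<lambda>ij. B $$ ij)) (col B m)"
    using assms by (intro eq_matI) (auto simp: snoc_col_def less_Suc_eq)
qed

lemma snoc_col_inject:
  assumes "A \<in> carrier_mat n m" "A' \<in> carrier_mat n m" "c \<in> carrier_vec n" "c' \<in> carrier_vec n"
    and eq: "snoc_col A c = snoc_col A' c'"
  shows "A = A' \<and> c = c'"
proof
  have *: "(if j < m then A $$ (i, j) else c $ i) = (if j < m then A' $$ (i, j) else c' $ i)"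
    if "i < n" "j < Suc m" for i j
  proof -
    have "snoc_col A c $$ (i, j) = snoc_col A' c' $$ (i, j)"
      using eq by simp
    then show ?thesis
      using assms(1,2) that by (simp add: snoc_col_def)
  qed
  show "A = A'"
  proof (rule eq_matI)
    fix i j assume "i < dim_row A'" "j < dim_col A'"
    then show "A $$ (i, j) = A' $$ (i, j)" using *[of i j] assms by simp
  qed (use assms in auto)
  show "c = c'"
  proof (rule eq_vecI)
    fix i assume "i < dim_vec c'"
    then show "c $ i = c' $ i" using *[of i m] assms by simp
  qed (use assms in auto)
qed

lemma set_cols_snoc_col:
  assumes "A \<in> carrier_mat n m" "c \<in> carrier_vec n"
  shows "set (cols (snoc_col A c)) = insert c (set (cols A))"
proof -
  have 1: "col (snoc_col A c) m = c"
    using assms by (intro eq_vecI) (auto simp: snoc_col_def)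
  have 2: "col (snoc_col A c) j = col A j" if "j < m" for j
    using assms that by (intro eq_vecI) (auto simp: snoc_col_def)
  have "set (cols (snoc_col A c)) = col (snoc_col A c) ` {..<Suc m}"
    using assms by (simp add: cols_def atLeast0LessThan lessThan_Suc)
  also have "\<dots> = insert c (col A ` {..<m})"
    by (simp add: lessThan_Suc 1 2)
  also have "\<dots> = insert c (set (cols A))"
    using assms by (simp add: cols_def atLeast0LessThan)
  finally show ?thesis .
qed

lemma index_mult_mat_vec_sum:
  assumes "A \<in> carrier_mat n m" "x \<in> carrier_vec m" "i < n"
  shows "(A *\<^sub>v x) $ i = (\<Sum>j<m. A $$ (i, j) * x $ j)"
  using assms by (simp add: scalar_prod_def atLeast0LessThan)

lemma snoc_col_mult_vec:
  fixes A :: "'a::field mat"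
  assumes "A \<in> carrier_mat n m" "c \<in> carrier_vec n" "x \<in> carrier_vec (Suc m)"
  shows "snoc_col A c *\<^sub>v x = A *\<^sub>v vec m (($) x) + x $ m \<cdot>\<^sub>v c"
proof (rule eq_vecI)
  fix i assume "i < dim_vec (A *\<^sub>v vec m (($) x) + x $ m \<cdot>\<^sub>v c)"
  then have i: "i < n" using assms by simp
  have "(snoc_col A c *\<^sub>v x) $ i = (\<Sum>j<Suc m. snoc_col A c $$ (i, j) * x $ j)"
    using assms i by (intro index_mult_mat_vec_sum) auto
  also have "\<dots> = (\<Sum>j<m. A $$ (i, j) * x $ j) + x $ m * c $ i"
    using assms i by (simp add: snoc_col_def)
  also have "(\<Sum>j<m. A $$ (i, j) * x $ j) = (A *\<^sub>v vec m (($) x)) $ i"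
    using assms i by (subst index_mult_mat_vec_sum[of _ n m]) auto
  finally show "(snoc_col A c *\<^sub>v x) $ i = (A *\<^sub>v vec m (($) x) + x $ m \<cdot>\<^sub>v c) $ i"
    using assms i by simp
qed (use assms in auto)

lemma mat_range_carrier: "A \<in> carrier_mat n m \<Longrightarrow> mat_range A \<subseteq> carrier_vec n"
  by (auto simp: mat_range_def)

lemma mat_range_add:
  assumes "u \<in> mat_range A" "v \<in> mat_range A"
  shows "u + v \<in> mat_range A"
proof -
  obtain x y where "u = A *\<^sub>v x" "v = A *\<^sub>v y" "x \<in> carrier_vec (dim_col A)" "y \<in> carrier_vec (dim_col A)"
    using assms by (auto simp: mat_range_def)
  then show ?thesis
    by (auto simp: mat_range_def mult_add_distrib_mat_vec[of A "dim_row A" "dim_col A", symmetric] intro!: imageI)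
qed

lemma mat_range_smult:
  assumes "u \<in> mat_range A"
  shows "k \<cdot>\<^sub>v u \<in> mat_range A"
proof -
  obtain x where "u = A *\<^sub>v x" "x \<in> carrier_vec (dim_col A)"
    using assms by (auto simp: mat_range_def)
  then show ?thesis
    by (auto simp: mat_range_def mult_mat_vec[of A "dim_row A" "dim_col A", symmetric] intro!: imageI)
qed

lemma mat_range_snoc_col:
  assumes "A \<in> carrier_mat n m" "c \<in> carrier_vec n"
  shows "mat_range (snoc_col A c) = (\<lambda>(w, k). w + k \<cdot>\<^sub>v c) ` (mat_range A \<times> UNIV)"
proof (intro equalityI subsetI)
  fix v assume "v \<in> mat_range (snoc_col A c)"
  then obtain x where x: "x \<in> carrier_vec (Suc m)" "v = snoc_col A c *\<^sub>v x"
    using assms by (auto simp: mat_range_def)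
  then have "v = A *\<^sub>v vec m (($) x) + x $ m \<cdot>\<^sub>v c"
    using assms by (simp add: snoc_col_mult_vec)
  then show "v \<in> (\<lambda>(w, k). w + k \<cdot>\<^sub>v c) ` (mat_range A \<times> UNIV)"
    using assms by (auto simp: mat_range_def intro!: image_eqI[of _ _ "(A *\<^sub>v vec m (($) x), x $ m)"])
next
  fix v assume "v \<in> (\<lambda>(w, k). w + k \<cdot>\<^sub>v c) ` (mat_range A \<times> UNIV)"
  then obtain y k where y: "y \<in> carrier_vec m" "v = A *\<^sub>v y + k \<cdot>\<^sub>v c"
    using assms by (auto simp: mat_range_def)
  define x where "x = vec (Suc m) (\<lambda>j. if j < m then y $ j else k)"
  have "vec m (($) x) = y" "x $ m = k"
    using y by (auto simp: x_def)
  then have "v = snoc_col A c *\<^sub>v x"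
    using assms y by (subst snoc_col_mult_vec) (auto simp: x_def)
  moreover have "x \<in> carrier_vec (Suc m)"
    by (simp add: x_def)
  ultimately show "v \<in> mat_range (snoc_col A c)"
    using assms by (auto simp: mat_range_def)
qed

section \<open>Effect of an appended column on the rank\<close>

context vec_space
begin

text \<open>A vector of \<open>C\<close> outside \<open>span S\<close> could be adjoined to
  \<open>S\<close> without losing independence, against maximality.\<close>

lemma span_maximal_indpt:
  assumes "C \<subseteq> carrier_vec n" "maximal S (\<lambda>T. T \<subseteq> C \<and> lin_indpt T)"
  shows "span S = span C"
proof (rule antisym)
  have S: "S \<subseteq> C" "lin_indpt S" and max: "\<And>T. S \<subseteq> T \<Longrightarrow> T \<subseteq> C \<Longrightarrow> lin_indpt T \<Longrightarrow> T = S"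
    using assms(2) unfolding maximal_def by auto
  show "span S \<subseteq> span C"
    using S(1) by (rule span_is_monotone)
  have "C \<subseteq> span S"
  proof
    fix c assume c: "c \<in> C"
    show "c \<in> span S"
    proof (rule ccontr)
      assume n: "c \<notin> span S"
      then have "lin_indpt (S \<union> {c})"
        using S c assms(1) lin_dep_iff_in_span[of S c] span_mem[of S c] by auto
      with max[of "S \<union> {c}"] S c have "c \<in> S" by auto
      then show False using n S(1) assms(1) span_mem[of S c] by auto
    qed
  qed
  then show "span C \<subseteq> span S"
    using S(1) assms(1) by (intro span_is_subset span_is_submodule) auto
qed

text \<open>The rank is the size of any maximal independent set \<open>S\<close> of columns. If c
  lies in the span, \<open>S\<close> remains maximal; otherwise \<open>S \<union> {c}\<close> is
  maximal for the enlarged set of columns.\<close>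

lemma rank_insert_col:
  assumes A: "A \<in> carrier_mat n m" and B: "B \<in> carrier_mat n m'" and c: "c \<in> carrier_vec n"
    and cols: "set (cols B) = insert c (set (cols A))"
  shows "rank B = (if c \<in> span (set (cols A)) then rank A else Suc (rank A))"
proof -
  let ?C = "set (cols A)"
  have C: "?C \<subseteq> carrier_vec n"
    using A cols_dim by blast
  have "lin_indpt {}"
    by (auto simp: lin_dep_def)
  then obtain S where max: "maximal S (\<lambda>T. T \<subseteq> ?C \<and> lin_indpt T)" and "finite S"
    using maximal_exists_superset[of ?C "\<lambda>T. T \<subseteq> ?C \<and> lin_indpt T" "{}"] by auto
  then have S: "S \<subseteq> ?C" "lin_indpt S" and max': "\<And>T. S \<subseteq> T \<Longrightarrow> T \<subseteq> ?C \<Longrightarrow> lin_indpt T \<Longrightarrow> T = S"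
    unfolding maximal_def by auto
  have span: "span S = span ?C"
    using C max by (rule span_maximal_indpt)
  have S_carrier: "S \<subseteq> carrier_vec n"
    using S C by auto
  have rA: "rank A = card S"
    using A max by (rule rank_card_indpt)
  show ?thesis
  proof (cases "c \<in> span ?C")
    case True
    have "T = S" if T: "S \<subseteq> T" "T \<subseteq> insert c ?C" "lin_indpt T" for T
    proof (cases "c \<in> S \<or> c \<notin> T")
      case True
      then have "T \<subseteq> ?C"
        using T(2) S(1) by auto
      then show ?thesis using T(1,3) by (intro max')
    next
      case False
      have "lin_indpt (S \<union> {c})"
        using T(3) by (rule subset_li_is_li) (use False T in auto)
      moreover have "lin_dep (S \<union> {c})"
        using lin_dep_iff_in_span[of S c] S S_carrier c True False span by auto
      ultimately show ?thesis by blast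
    qed
    then have "maximal S (\<lambda>T. T \<subseteq> set (cols B) \<and> lin_indpt T)"
      unfolding maximal_def cols using S by auto
    with rank_card_indpt[OF B] rA True show ?thesis by simp
  next
    case False
    then have cS: "c \<notin> S" "c \<notin> ?C"
      using span_mem[of ?C c] C S by auto
    have "lin_indpt (S \<union> {c})"
      using lin_dep_iff_in_span[of S c] S S_carrier c False cS span by auto
    moreover have "T = S \<union> {c}" if T: "S \<union> {c} \<subseteq> T" "T \<subseteq> insert c ?C" "lin_indpt T" for T
    proof -
      have "lin_indpt (T - {c})"
        using T(3) by (rule subset_li_is_li) auto
      then have "T - {c} = S"
        using T cS by (intro max') auto
      then show ?thesis using T by auto
    qed
    ultimately have "maximal (S \<union> {c}) (\<lambda>T. T \<subseteq> set (cols B) \<and> lin_indpt T)"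
      unfolding maximal_def cols using S by auto
    from rank_card_indpt[OF B this] show ?thesis
      using rA False cS \<open>finite S\<close> by simp
  qed
qed

lemma span_cols_eq_mat_range:
  assumes "A \<in> carrier_mat n m"
  shows "span (set (cols A)) = mat_range A"
  using col_space_eq[OF assms] assms unfolding col_space_def mat_range_def by auto

end

lemma mat_rank_snoc_col:
  assumes "A \<in> carrier_mat n m" "c \<in> carrier_vec n"
  shows "vec_space.rank n (snoc_col A c) = (if c \<in> mat_range A then vec_space.rank n A else Suc (vec_space.rank n A))"
  using vec_space.rank_insert_col[of A n m "snoc_col A c" "Suc m" c] assms
  by (simp add: set_cols_snoc_col vec_space.span_cols_eq_mat_range)

section \<open>Cardinality of the column space and invariance of the rank\<close>

lemma finite_carrier_vec: "finite (carrier_vec n :: 'a::finite vec set)"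
proof (rule finite_subset)
  show "carrier_vec n \<subseteq> vec_of_list ` {xs :: 'a list. set xs \<subseteq> UNIV \<and> length xs = n}"
  proof
    fix v :: "'a vec" assume "v \<in> carrier_vec n"
    then have "v = vec_of_list (list_of_vec v)" "length (list_of_vec v) = n"
      by (auto simp: vec_list)
    then show "v \<in> vec_of_list ` {xs :: 'a list. set xs \<subseteq> UNIV \<and> length xs = n}"
      by blast
  qed
qed (intro finite_imageI finite_lists_length_eq finite)

lemma mat_range_0_cols:
  assumes "A \<in> carrier_mat n 0"
  shows "mat_range A = {0\<^sub>v n}"
proof -
  have "A *\<^sub>v x = 0\<^sub>v n" if "x \<in> carrier_vec 0" for x
    using assms that by (intro eq_vecI) (auto simp: scalar_prod_def)
  moreover have "0\<^sub>v 0 \<in> carrier_vec 0" by simp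
  ultimately show ?thesis
    using assms unfolding mat_range_def by (metis (no_types, lifting) carrier_matD(2) empty_iff image_constant image_cong)
qed

text \<open>Induction on the columns: a new column inside the column space changes nothing, while
  one outside multiplies the size by q because (w, k) \<mapsto> w + k c is injective.\<close>

lemma card_mat_range:
  fixes A :: "'a::{field, finite} mat"
  assumes "A \<in> carrier_mat n m"
  shows "card (mat_range A) = card (UNIV :: 'a set) ^ vec_space.rank n A"
  using assms
proof (induction m arbitrary: A)
  case 0
  then have "vec_space.rank n A = 0"
    using vec_space.rank_le_nc[of A n 0] by simp
  then show ?case using 0 by (simp add: mat_range_0_cols)
next
  case (Suc m)
  from Suc.prems obtain A' c
    where A': "A' \<in> carrier_mat n m" "c \<in> carrier_vec n" and A: "A = snoc_col A' c"
    by (rule snoc_col_cases)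
  have IH: "card (mat_range A') = card (UNIV :: 'a set) ^ vec_space.rank n A'"
    using A'(1) by (rule Suc.IH)
  show ?case
  proof (cases "c \<in> mat_range A'")
    case True
    have "mat_range A = mat_range A'"
    proof (intro equalityI subsetI)
      fix v assume "v \<in> mat_range A"
      then show "v \<in> mat_range A'"
        unfolding A mat_range_snoc_col[OF A'] using True by (auto intro: mat_range_add mat_range_smult)
    next
      fix v assume v: "v \<in> mat_range A'"
      then have "v \<in> carrier_vec n"
        using mat_range_carrier[OF A'(1)] by blast
      then have "v = v + 0 \<cdot>\<^sub>v c"
        using A'(2) by (intro eq_vecI) auto
      then show "v \<in> mat_range A"
        unfolding A mat_range_snoc_col[OF A'] using v by (auto intro!: image_eqI[of _ _ "(v, 0)"])
    qed
    then show ?thesis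
      using True A' IH by (simp add: A mat_rank_snoc_col)
  next
    case False
    have "inj_on (\<lambda>(w, k). w + k \<cdot>\<^sub>v c) (mat_range A' \<times> UNIV)"
    proof (rule inj_onI, clarsimp)
      fix w k w' k'
      assume w: "w \<in> mat_range A'" "w' \<in> mat_range A'" and eq: "w + k \<cdot>\<^sub>v c = w' + k' \<cdot>\<^sub>v c"
      have wc: "w \<in> carrier_vec n" "w' \<in> carrier_vec n"
        using w mat_range_carrier[OF A'(1)] by auto
      have e: "w $ i + k * c $ i = w' $ i + k' * c $ i" if "i < n" for i
        using arg_cong[OF eq, of "\<lambda>v. v $ i"] wc A'(2) that by simp
      have "k = k'"
      proof (rule ccontr)
        assume "k \<noteq> k'"
        \<comment> \<open>Solving w + k c = w' + k' c for c would place c in the column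
          space.\<close>
        then have "c = inverse (k - k') \<cdot>\<^sub>v (w' + (-1) \<cdot>\<^sub>v w)"
          using wc A'(2) e by (intro eq_vecI) (auto simp: field_simps)
        then show False
          using False w by (metis mat_range_add mat_range_smult)
      qed
      moreover have "w = w'"
        using wc e \<open>k = k'\<close> by (intro eq_vecI) auto
      ultimately show "w = w' \<and> k = k'" by simp
    qed
    then show ?thesis
      unfolding A mat_range_snoc_col[OF A']
      using False A' IH by (simp add: card_image mat_rank_snoc_col card_cartesian_product)
  qed
qed

lemma CARD_field_gt_1: "1 < card (UNIV :: 'a::{field, finite} set)"
  using card_mono[of "UNIV :: 'a set" "{0, 1}"] by simp

text \<open>Powers of the field order are injective in the exponent, so comparing ranks reduces to
  comparing the sizes of column spaces.\<close>

lemma mat_rank_eqI: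
  fixes A B :: "'a::{field, finite} mat"
  assumes "A \<in> carrier_mat n m" "B \<in> carrier_mat k l" "card (mat_range A) = card (mat_range B)"
  shows "vec_space.rank n A = vec_space.rank k B"
  using assms(3) CARD_field_gt_1[where 'a = 'a]
  by (simp add: card_mat_range[OF assms(1)] card_mat_range[OF assms(2)])

lemma mat_rank_snoc_zero_row:
  fixes A :: "'a::{field, finite} mat"
  assumes "A \<in> carrier_mat n m"
  shows "vec_space.rank (Suc n) (snoc_zero_row A) = vec_space.rank n A"
proof (rule mat_rank_eqI[of _ _ m _ _ m])
  define f :: "'a vec \<Rightarrow> 'a vec" where "f v = vec (Suc n) (\<lambda>i. if i < n then v $ i else 0)" for v
  have "snoc_zero_row A *\<^sub>v x = f (A *\<^sub>v x)" if x: "x \<in> carrier_vec m" for x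
    using assms x by (intro eq_vecI)
      (auto simp: f_def snoc_zero_row_def scalar_prod_def)
  then have "mat_range (snoc_zero_row A) = f ` mat_range A"
    using assms by (auto simp: mat_range_def image_image)
  moreover have "inj_on f (carrier_vec n)"
  proof (rule inj_onI)
    fix u v assume uv: "u \<in> carrier_vec n" "v \<in> carrier_vec n" "f u = f v"
    show "u = v"
    proof (rule eq_vecI)
      fix i assume "i < dim_vec v"
      then have "u $ i = f u $ i" "v $ i = f v $ i"
        using uv(1,2) by (simp_all add: f_def)
      then show "u $ i = v $ i" using uv(3) by simp
    qed (use uv in auto)
  qed
  ultimately show "card (mat_range (snoc_zero_row A)) = card (mat_range A)"
    using mat_range_carrier[OF assms] by (simp add: card_image inj_on_subset)
qed (use assms in auto)

lemma mat_range_mult_left: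
  assumes "A \<in> carrier_mat n m" "G \<in> carrier_mat k n"
  shows "mat_range (G * A) = (\<lambda>v. G *\<^sub>v v) ` mat_range A"
  using assms by (auto simp: mat_range_def image_image assoc_mult_mat_vec[of G k n A m])

lemma mat_rank_mult_left:
  fixes A :: "'a::{field, finite} mat"
  assumes "A \<in> carrier_mat n m" "G \<in> carrier_mat n n" "G' \<in> carrier_mat n n" "G' * G = 1\<^sub>m n"
  shows "vec_space.rank n (G * A) = vec_space.rank n A"
proof (rule mat_rank_eqI[of _ _ m _ _ m])
  have "inj_on (\<lambda>v. G *\<^sub>v v) (carrier_vec n)"
  proof (rule inj_onI)
    fix u v assume uv: "u \<in> carrier_vec n" "v \<in> carrier_vec n" "G *\<^sub>v u = G *\<^sub>v v"
    then have "G' *\<^sub>v (G *\<^sub>v u) = G' *\<^sub>v (G *\<^sub>v v)" by simp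
    then show "u = v"
      using uv(1,2) assms(4) by (simp flip: assoc_mult_mat_vec[OF assms(3,2) uv(1)] assoc_mult_mat_vec[OF assms(3,2) uv(2)])
  qed
  then show "card (mat_range (G * A)) = card (mat_range A)"
    unfolding mat_range_mult_left[OF assms(1,2)]
    using mat_range_carrier[OF assms(1)] by (simp add: card_image inj_on_subset)
qed (use assms in auto)

text \<open>Since H maps \<open>carrier_vec m\<close> onto itself, the column space does not even
  change as a set.\<close>

lemma mat_rank_mult_right:
  fixes A :: "'a::{field, finite} mat"
  assumes "A \<in> carrier_mat n m" "H \<in> carrier_mat m m" "H' \<in> carrier_mat m m" "H * H' = 1\<^sub>m m"
  shows "vec_space.rank n (A * H) = vec_space.rank n A"
proof (rule mat_rank_eqI[of _ _ m _ _ m])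
  have "(\<lambda>v. H *\<^sub>v v) ` carrier_vec m = carrier_vec m"
  proof (intro equalityI subsetI)
    fix v :: "'a vec" assume v: "v \<in> carrier_vec m"
    then have "v = H *\<^sub>v (H' *\<^sub>v v)"
      using assms(4) by (simp flip: assoc_mult_mat_vec[OF assms(2,3) v])
    then show "v \<in> (\<lambda>v. H *\<^sub>v v) ` carrier_vec m"
      using v assms by (intro image_eqI[of _ _ "H' *\<^sub>v v"]) auto
  qed (use assms in auto)
  then have "(\<lambda>v. A *\<^sub>v (H *\<^sub>v v)) ` carrier_vec m = (\<lambda>v. A *\<^sub>v v) ` carrier_vec m"
    by (metis image_image)
  then have "mat_range (A * H) = mat_range A"
    using assms by (simp add: mat_range_def assoc_mult_mat_vec[of A n m H m] cong: image_cong_simp)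
  then show "card (mat_range (A * H)) = card (mat_range A)" by simp
qed (use assms in auto)

lemma mat_rank_eq_0_iff:
  assumes "A \<in> carrier_mat n m"
  shows "vec_space.rank n A = 0 \<longleftrightarrow> A = 0\<^sub>m n m"
proof
  assume "A = 0\<^sub>m n m"
  then show "vec_space.rank n A = 0" by (simp add: vec_space.rank_0I)
next
  assume "vec_space.rank n A = 0"
  then show "A = 0\<^sub>m n m"
    using assms
  proof (induction m arbitrary: A)
    case 0
    then show ?case by (intro eq_matI) auto
  next
    case (Suc m)
    from Suc.prems(2) obtain A' c where A': "A' \<in> carrier_mat n m" "c \<in> carrier_vec n" and A: "A = snoc_col A' c"
      by (rule snoc_col_cases)
    have *: "c \<in> mat_range A'" "vec_space.rank n A' = 0"
      using Suc.prems(1) A' unfolding A by (auto simp: mat_rank_snoc_col split: if_splits)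
    then have 0: "A' = 0\<^sub>m n m"
      using Suc.IH A'(1) by blast
    with * have "c = 0\<^sub>v n"
      by (auto simp: mat_range_def)
    then show ?case
      unfolding A 0 by (intro eq_matI) (auto simp: snoc_col_def)
  qed
qed

subsection \<open>Reduction to corner form\<close>

text \<open>The inverse is carried explicitly, so that products and transposes come with their
  inverses.\<close>

definition inverse_mats :: "nat \<Rightarrow> 'a::semiring_1 mat \<Rightarrow> 'a mat \<Rightarrow> bool" where
  "inverse_mats n G G' \<longleftrightarrow>
     G \<in> carrier_mat n n \<and> G' \<in> carrier_mat n n \<and> G * G' = 1\<^sub>m n \<and> G' * G = 1\<^sub>m n"

lemma inverse_mats_mult:
  assumes "inverse_mats n G G'" "inverse_mats n H H'"
  shows "inverse_mats n (G * H) (H' * G')"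
proof -
  have c: "G \<in> carrier_mat n n" "G' \<in> carrier_mat n n" "H \<in> carrier_mat n n" "H' \<in> carrier_mat n n"
    and i: "G * G' = 1\<^sub>m n" "G' * G = 1\<^sub>m n" "H * H' = 1\<^sub>m n" "H' * H = 1\<^sub>m n"
    using assms by (simp_all add: inverse_mats_def)
  have "G * H * (H' * G') = G * (H * H') * G'"
    using c by (simp add: assoc_mult_mat[of _ n n _ n _ n])
  moreover have "H' * G' * (G * H) = H' * (G' * G) * H"
    using c by (simp add: assoc_mult_mat[of _ n n _ n _ n])
  ultimately show ?thesis
    using c i by (simp add: inverse_mats_def)
qed

lemma inverse_mats_transpose:
  fixes G :: "'a::comm_semiring_1 mat"
  assumes "inverse_mats n G G'"
  shows "inverse_mats n (transpose_mat G) (transpose_mat G')"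
  using assms by (simp add: inverse_mats_def flip: transpose_mult[of _ n n _ n])

lemma inverse_mats_swaprows:
  "k < n \<Longrightarrow> l < n \<Longrightarrow> inverse_mats n (swaprows_mat n k l) (swaprows_mat n k l)"
  by (simp add: inverse_mats_def swaprows_mat_inv)

text \<open>Left multiplication adds \<open>u i\<close> times the last row to each row i < n, a
  whole elimination step in one matrix; negating u inverts it.\<close>

definition last_col_shear :: "nat \<Rightarrow> (nat \<Rightarrow> 'a::comm_ring_1) \<Rightarrow> 'a mat" where
  "last_col_shear n u = mat (Suc n) (Suc n) (\<lambda>(i, j). if i = j then 1 else if j = n then u i else 0)"

lemma last_col_shear_carrier [simp]: "last_col_shear n u \<in> carrier_mat (Suc n) (Suc n)"
  by (simp add: last_col_shear_def)

lemma index_last_col_shear_mult: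
  assumes "A \<in> carrier_mat (Suc n) m" "i < Suc n" "j < m"
  shows "(last_col_shear n u * A) $$ (i, j) = (if i < n then A $$ (i, j) + u i * A $$ (n, j) else A $$ (n, j))"
proof -
  have "(last_col_shear n u * A) $$ (i, j) = (\<Sum>k<Suc n. last_col_shear n u $$ (i, k) * A $$ (k, j))"
    using assms by (simp add: scalar_prod_def atLeast0LessThan last_col_shear_def)
  also have "\<dots> = (\<Sum>k<n. (if i = k then A $$ (k, j) else 0)) + (if i = n then 1 else u i) * A $$ (n, j)"
  proof -
    have "(\<Sum>k<n. last_col_shear n u $$ (i, k) * A $$ (k, j)) = (\<Sum>k<n. (if i = k then A $$ (k, j) else 0))"
      using assms by (intro sum.cong) (auto simp: last_col_shear_def)
    then show ?thesis
      using assms by (simp add: last_col_shear_def)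
  qed
  also have "\<dots> = (if i < n then A $$ (i, j) + u i * A $$ (n, j) else A $$ (n, j))"
    using assms by (auto simp: less_Suc_eq)
  finally show ?thesis .
qed

lemma inverse_mats_last_col_shear:
  "inverse_mats (Suc n) (last_col_shear n u) (last_col_shear n (\<lambda>i. - u i))"
proof -
  have "last_col_shear n u * last_col_shear n v = 1\<^sub>m (Suc n)" if "\<And>i. u i + v i = 0" for u v :: "nat \<Rightarrow> 'a"
  proof (rule eq_matI)
    fix i j assume "i < dim_row (1\<^sub>m (Suc n) :: 'a mat)" "j < dim_col (1\<^sub>m (Suc n) :: 'a mat)"
    then have ij: "i < Suc n" "j < Suc n" by auto
    then show "(last_col_shear n u * last_col_shear n v) $$ (i, j) = 1\<^sub>m (Suc n) $$ (i, j)"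
      using that[of i] by (subst index_last_col_shear_mult[of _ n "Suc n"])
        (auto simp: last_col_shear_def less_Suc_eq add.commute)
  qed (auto simp: last_col_shear_def)
  then show ?thesis by (simp add: inverse_mats_def)
qed

text \<open>The block diagonal matrix with blocks A and p, assembled row first and column second so
  that the lemmas on appended rows and columns apply.\<close>

definition corner_mat :: "'a::semiring_1 mat \<Rightarrow> 'a \<Rightarrow> 'a mat" where
  "corner_mat A p = snoc_col (snoc_zero_row A) (p \<cdot>\<^sub>v unit_vec (Suc (dim_row A)) (dim_row A))"

lemma corner_mat_carrier [simp]:
  "A \<in> carrier_mat n m \<Longrightarrow> corner_mat A p \<in> carrier_mat (Suc n) (Suc m)"
  by (simp add: corner_mat_def)

text \<open>The appended column is non-zero in the last row, where every vector of the column space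
  of \<open>snoc_zero_row A\<close> vanishes.\<close>

lemma mat_rank_corner_mat:
  fixes A :: "'a::{field, finite} mat"
  assumes A: "A \<in> carrier_mat n m" and "p \<noteq> 0"
  shows "vec_space.rank (Suc n) (corner_mat A p) = Suc (vec_space.rank n A)"
proof -
  let ?c = "p \<cdot>\<^sub>v unit_vec (Suc n) n"
  have "?c \<notin> mat_range (snoc_zero_row A)"
  proof
    assume "?c \<in> mat_range (snoc_zero_row A)"
    then obtain x where x: "x \<in> carrier_vec m" "?c = snoc_zero_row A *\<^sub>v x"
      using A by (auto simp: mat_range_def)
    have "(snoc_zero_row A *\<^sub>v x) $ n = (\<Sum>j<m. snoc_zero_row A $$ (n, j) * x $ j)"
      using A x by (intro index_mult_mat_vec_sum[of _ "Suc n"]) auto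
    also have "\<dots> = 0"
      using A by (simp add: snoc_zero_row_def)
    finally show False
      using \<open>p \<noteq> 0\<close> unfolding x(2)[symmetric] by simp
  qed
  then show ?thesis
    using A mat_rank_snoc_col[of "snoc_zero_row A" "Suc n" m ?c]
    by (simp add: corner_mat_def mat_rank_snoc_zero_row)
qed

text \<open>One round of Gaussian elimination: swaps bring a non-zero entry to the last corner, a
  shear clears the rest of its column, and a transposed shear clears the rest of its row.\<close>

lemma corner_mat_decomposition:
  fixes a :: "'a::field mat"
  assumes a: "a \<in> carrier_mat n m" and "a \<noteq> 0\<^sub>m n m"
  obtains n' m' G G' H H' b p where "n = Suc n'" "m = Suc m'" "inverse_mats n G G'" "inverse_mats m H H'"
    "b \<in> carrier_mat n' m'" "p \<noteq> 0" "a = G * corner_mat b p * H"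
proof -
  obtain i j where ij: "i < n" "j < m" "a $$ (i, j) \<noteq> 0"
    using assms by (metis (no_types, lifting) carrier_matD eq_matI index_zero_mat)
  then obtain n' m' where n: "n = Suc n'" and m: "m = Suc m'"
    by (metis less_imp_Suc_add)
  define P :: "'a mat" where "P = swaprows_mat n i n'"
  define Q :: "'a mat" where "Q = swaprows_mat m j m'"
  have PQ: "P \<in> carrier_mat n n" "Q \<in> carrier_mat m m" "P * P = 1\<^sub>m n" "Q * Q = 1\<^sub>m m"
    using ij by (auto simp: P_def Q_def n m swaprows_mat_inv)
  define a1 where "a1 = swapcols j m' (swaprows i n' a)"
  have a1: "a1 \<in> carrier_mat n m"
    using a by (simp add: a1_def)
  define p where "p = a1 $$ (n', m')"
  have p: "p \<noteq> 0"
    using ij a by (auto simp: p_def a1_def n m)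
  have "a1 = P * a * Q"
    unfolding a1_def P_def Q_def using a ij
    by (subst swapcols_mat[of _ n m]) (auto simp: n m swaprows_mat[of _ n m])
  then have "P * a1 * Q = (P * P) * a * (Q * Q)"
    using a PQ(1,2) by (simp add: assoc_mult_mat[of _ n n _ n _ m] assoc_mult_mat[of _ n m _ m _ m]
        assoc_mult_mat[of _ n n _ m _ m])
  then have a_eq: "a = P * a1 * Q"
    using a PQ by simp
  \<comment> \<open>The multiples of the last row whose subtraction clears the last column above the
    pivot.\<close>
  define u where "u i = a1 $$ (i, m') / p" for i
  define U where "U = last_col_shear n' u"
  define U' where "U' = last_col_shear n' (\<lambda>i. - u i)"
  have U: "inverse_mats n U U'"
    unfolding U_def U'_def n by (rule inverse_mats_last_col_shear)
  define a2 where "a2 = U' * a1"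
  have Uc: "U \<in> carrier_mat n n" "U' \<in> carrier_mat n n"
    using U by (auto simp: inverse_mats_def)
  have a2: "a2 \<in> carrier_mat n m"
    using a1 Uc by (simp add: a2_def)
  have a2_index: "a2 $$ (i, j) = (if i < n' then a1 $$ (i, j) - u i * a1 $$ (n', j) else a1 $$ (n', j))"
    if "i < n" "j < m" for i j
    using that a1 unfolding a2_def U'_def n by (subst index_last_col_shear_mult) auto
  have a1_eq: "a1 = U * a2"
    using U a1 unfolding a2_def inverse_mats_def by (simp flip: assoc_mult_mat[of _ n n _ n _ m])
  define v where "v j = a2 $$ (n', j) / p" for j
  define V where "V = last_col_shear m' v"
  define V' where "V' = last_col_shear m' (\<lambda>i. - v i)"
  have V: "inverse_mats m V V'"
    unfolding V_def V'_def m by (rule inverse_mats_last_col_shear)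
  \<comment> \<open>Column operations are row operations on the transpose, so the same shear serves
    again. The row being cleared is still that of \<open>a1\<close>, as \<open>U'\<close> fixes the
    last row.\<close>
  define a3 where "a3 = transpose_mat (V' * transpose_mat a2)"
  have Vc: "V \<in> carrier_mat m m" "V' \<in> carrier_mat m m"
    using V by (auto simp: inverse_mats_def)
  have a3: "a3 \<in> carrier_mat n m"
    using a2 Vc by (simp add: a3_def)
  have a3_index: "a3 $$ (i, j) = (if j < m' then a2 $$ (i, j) - v j * a2 $$ (i, m') else a2 $$ (i, m'))"
    if "i < n" "j < m" for i j
  proof -
    have "a3 $$ (i, j) = (V' * transpose_mat a2) $$ (j, i)"
      using that a2 Vc by (simp add: a3_def)
    also have "\<dots> = (if j < m' then transpose_mat a2 $$ (j, i) + - v j * transpose_mat a2 $$ (m', i)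
        else transpose_mat a2 $$ (m', i))"
      unfolding V'_def using that a2 by (intro index_last_col_shear_mult) (auto simp: m)
    finally show ?thesis
      using that a2 by (simp add: m)
  qed
  have "transpose_mat a2 = V * (V' * transpose_mat a2)"
    using V a2 unfolding inverse_mats_def by (simp flip: assoc_mult_mat[of _ m m _ m _ n])
  then have "a2 = transpose_mat (V * (V' * transpose_mat a2))"
    by (metis transpose_transpose)
  also have "\<dots> = a3 * transpose_mat V"
    unfolding a3_def using a2 Vc by (subst transpose_mult[of V m m _ n]) auto
  finally have a2_eq: "a2 = a3 * transpose_mat V" .
  define b where "b = mat n' m' (\<lambda>ij. a3 $$ ij)"
  have b: "b \<in> carrier_mat n' m'"
    by (simp add: b_def)
  have "a3 = corner_mat b p"
  proof (rule eq_matI)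
    fix i j assume "i < dim_row (corner_mat b p)" "j < dim_col (corner_mat b p)"
    then have ij: "i < n" "j < m"
      using b by (auto simp: n m corner_mat_def)
    show "a3 $$ (i, j) = corner_mat b p $$ (i, j)"
      using ij p b
      by (auto simp: a3_index a2_index corner_mat_def snoc_col_def snoc_zero_row_def b_def n m u_def v_def
          less_Suc_eq p_def[symmetric])
  qed (use a3 b in \<open>auto simp: n m corner_mat_def\<close>)
  then have "a = P * (U * (corner_mat b p * transpose_mat V)) * Q"
    using a_eq a1_eq a2_eq by simp
  also have "\<dots> = (P * U) * corner_mat b p * (transpose_mat V * Q)"
  proof -
    have "corner_mat b p \<in> carrier_mat n m" using b by (simp add: n m)
    then show ?thesis
      using PQ(1,2) Uc Vc
      by (simp add: assoc_mult_mat[of _ n n _ n _ m] assoc_mult_mat[of _ n m _ m _ m]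
        assoc_mult_mat[of _ n n _ m _ m])
  qed
  finally have "a = (P * U) * corner_mat b p * (transpose_mat V * Q)" .
  moreover have "inverse_mats n (P * U) (U' * P)"
    using U ij by (intro inverse_mats_mult) (auto simp: P_def n inverse_mats_swaprows)
  moreover have "inverse_mats m (transpose_mat V * Q) (Q * transpose_mat V')"
    using V ij by (intro inverse_mats_mult inverse_mats_transpose) (auto simp: Q_def m inverse_mats_swaprows)
  ultimately show thesis
    using that n m b p by blast
qed

text \<open>Adding corner entries 1 to a zero matrix raises the rank one by one. Without such a
  witness the description in \<open>canonical_matrix\<close> would not determine a value.\<close>

lemma exists_mat_of_rank:
  assumes "s \<le> n" "s \<le> m"
  shows "\<exists>a \<in> carrier_mat n m. vec_space.rank n (a :: 'a::{field, finite} mat) = s"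
  using assms
proof (induction s arbitrary: n m)
  case 0
  show ?case by (intro bexI[of _ "0\<^sub>m n m"]) (auto simp: vec_space.rank_0I)
next
  case (Suc s)
  then obtain n' m' where nm: "n = Suc n'" "m = Suc m'" "s \<le> n'" "s \<le> m'"
    by (metis Suc_le_D Suc_le_mono)
  then obtain a :: "'a mat" where "a \<in> carrier_mat n' m'" "vec_space.rank n' a = s"
    using Suc.IH by blast
  then show ?case
    unfolding nm by (intro bexI[of _ "corner_mat a 1"]) (auto simp: mat_rank_corner_mat)
qed

section \<open>The trace pairing under equivalence and bordering\<close>

lemma mat_trace_mult_commute:
  fixes A :: "'a::comm_semiring_0 mat"
  assumes "A \<in> carrier_mat n m" "B \<in> carrier_mat m n"
  shows "mat_trace (A * B) = mat_trace (B * A)"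
proof -
  have "mat_trace (A * B) = (\<Sum>i<n. \<Sum>j<m. A $$ (i, j) * B $$ (j, i))"
    using assms by (auto simp: mat_trace_def scalar_prod_def atLeast0LessThan intro!: sum.cong)
  also have "\<dots> = (\<Sum>j<m. \<Sum>i<n. B $$ (j, i) * A $$ (i, j))"
    by (subst sum.swap) (simp add: mult.commute)
  also have "\<dots> = mat_trace (B * A)"
    using assms by (auto simp: mat_trace_def scalar_prod_def atLeast0LessThan intro!: sum.cong)
  finally show ?thesis .
qed

text \<open>The transpose reverses the product, and cyclicity of the trace moves the transpose of H
  to the far right.\<close>

lemma mat_pairing_mult:
  fixes a :: "'a::comm_semiring_0 mat"
  assumes "a \<in> carrier_mat n m" "b \<in> carrier_mat n m" "G \<in> carrier_mat n n" "H \<in> carrier_mat m m"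
  shows "mat_pairing (G * a * H) b = mat_pairing a (transpose_mat G * b * transpose_mat H)"
proof -
  define X where "X = transpose_mat a * (transpose_mat G * b)"
  have X: "X \<in> carrier_mat m m"
    using assms by (simp add: X_def)
  have "transpose_mat (G * a * H) = transpose_mat H * (transpose_mat a * transpose_mat G)"
    using assms by (simp add: transpose_mult[of _ n m _ m] transpose_mult[of _ n n _ m])
  then have "transpose_mat (G * a * H) * b = transpose_mat H * X"
    unfolding X_def using assms
    by (simp add: assoc_mult_mat[of _ m n _ n _ m] assoc_mult_mat[of _ m m _ n _ m])
  moreover have "transpose_mat a * (transpose_mat G * b * transpose_mat H) = X * transpose_mat H"
    unfolding X_def using assms
    by (simp add: assoc_mult_mat[of _ m n _ m _ m] assoc_mult_mat[of _ n n _ m _ m])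
  ultimately show ?thesis
    unfolding mat_pairing_def using assms X mat_trace_mult_commute[of X m m "transpose_mat H"] by simp
qed

lemma mat_pairing_sum:
  assumes "a \<in> carrier_mat n m" "b \<in> carrier_mat n m"
  shows "mat_pairing a b = (\<Sum>j<m. \<Sum>i<n. a $$ (i, j) * b $$ (i, j))"
  using assms
  by (auto simp: mat_pairing_def mat_trace_def scalar_prod_def atLeast0LessThan intro!: sum.cong)

lemma mat_pairing_snoc_col:
  assumes "a \<in> carrier_mat n m" "b \<in> carrier_mat n m" "c \<in> carrier_vec n" "d \<in> carrier_vec n"
  shows "mat_pairing (snoc_col a c) (snoc_col b d) = mat_pairing a b + c \<bullet> d"
  using assms
  by (simp add: mat_pairing_sum[of _ n "Suc m"] mat_pairing_sum[of _ n m] scalar_prod_def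
      atLeast0LessThan snoc_col_def)

lemma mat_pairing_snoc_zero_row:
  assumes "a \<in> carrier_mat n m" "b \<in> carrier_mat n m"
  shows "mat_pairing (snoc_zero_row a) (snoc_zero_row b) = mat_pairing a b"
  using assms
  by (simp add: mat_pairing_sum[of _ "Suc n" m] mat_pairing_sum[of _ n m] snoc_zero_row_def)

lemma mat_pairing_zero: "b \<in> carrier_mat n m \<Longrightarrow> mat_pairing (0\<^sub>m n m) b = 0"
  "a \<in> carrier_mat n m \<Longrightarrow> mat_pairing a (0\<^sub>m n m) = 0"
  by (simp_all add: mat_pairing_sum[of _ n m])

subsection \<open>Character sums over matrices of fixed rank\<close>

lemma finite_carrier_mat: "finite (carrier_mat n m :: 'a::finite mat set)"
proof (induction m)
  case 0
  have "A = B" if "A \<in> carrier_mat n 0" "B \<in> carrier_mat n 0" for A B :: "'a mat"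
    using that by (intro eq_matI) auto
  then have "carrier_mat n 0 \<subseteq> {mat n 0 undefined :: 'a mat}"
    by auto
  then show ?case by (rule finite_subset) simp
next
  case (Suc m)
  have "carrier_mat n (Suc m) \<subseteq> (\<lambda>(A, c). snoc_col A c) ` (carrier_mat n m \<times> (carrier_vec n :: 'a vec set))"
    by (auto elim!: snoc_col_cases)
  then show ?case
    using Suc finite_carrier_vec by (rule finite_subset[OF _ finite_imageI[OF finite_cartesian_product]])
qed

text \<open>The sum carries no conjugation: the theorem takes for \<open>\<psi>\<close> the
  conjugate of \<theta>.\<close>

definition rank_sum :: "('a::field \<Rightarrow> complex) \<Rightarrow> nat \<Rightarrow> nat \<Rightarrow> 'a mat \<Rightarrow> nat \<Rightarrow> complex" where
  "rank_sum \<psi> n m a r = (\<Sum>b \<in> {b \<in> carrier_mat n m. vec_space.rank n b = r}. \<psi> (mat_pairing a b))"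

text \<open>The pairing moves G and H onto b, and multiplying b by their transposes permutes the
  matrices of rank r, with G' and H' giving the inverse map.\<close>

lemma rank_sum_equiv:
  fixes a :: "'a::{field, finite} mat"
  assumes "a \<in> carrier_mat n m" "inverse_mats n G G'" "inverse_mats m H H'"
  shows "rank_sum \<psi> n m (G * a * H) r = rank_sum \<psi> n m a r"
proof -
  have equiv: "transpose_mat K * (transpose_mat K' * b * transpose_mat L') * transpose_mat L = b"
    "transpose_mat K' * b * transpose_mat L' \<in> carrier_mat n m"
    "vec_space.rank n (transpose_mat K' * b * transpose_mat L') = vec_space.rank n b"
    if "inverse_mats n K K'" "inverse_mats m L L'" "b \<in> carrier_mat n m" for K K' L L' and b :: "'a mat"
  proof -
    define S S' T T' where "S = transpose_mat K" "S' = transpose_mat K'"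
      "T = transpose_mat L" "T' = transpose_mat L'"
    note defs = this
    have S: "S \<in> carrier_mat n n" "S' \<in> carrier_mat n n" "S * S' = 1\<^sub>m n"
      and T: "T \<in> carrier_mat m m" "T' \<in> carrier_mat m m" "T' * T = 1\<^sub>m m"
      using that(1,2)[THEN inverse_mats_transpose] by (auto simp: inverse_mats_def defs)
    have "S * (S' * b * T') * T = (S * S') * b * (T' * T)"
      using S(1,2) T(1,2) that(3) by (simp add: assoc_mult_mat[of _ n n _ n _ m]
          assoc_mult_mat[of _ n m _ m _ m] assoc_mult_mat[of _ n n _ m _ m])
    then show "transpose_mat K * (transpose_mat K' * b * transpose_mat L') * transpose_mat L = b"
      using that(3) S T by (simp flip: defs)
    show "transpose_mat K' * b * transpose_mat L' \<in> carrier_mat n m"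
      using that(3) S T by (simp flip: defs)
    show "vec_space.rank n (transpose_mat K' * b * transpose_mat L') = vec_space.rank n b"
      using mat_rank_mult_right[of "S' * b" n m T' T] mat_rank_mult_left[of b n m S' S] that(3) S T
      by (simp flip: defs)
  qed
  have inv: "inverse_mats n G' G" "inverse_mats m H' H"
    and GH: "G \<in> carrier_mat n n" "H \<in> carrier_mat m m"
    using assms by (auto simp: inverse_mats_def)
  have pairing: "\<psi> (mat_pairing a (transpose_mat G * b * transpose_mat H)) = \<psi> (mat_pairing (G * a * H) b)"
    if "b \<in> carrier_mat n m" for b
    by (simp only: mat_pairing_mult[OF assms(1) that GH])
  show ?thesis
    unfolding rank_sum_def
    by (rule sum.reindex_bij_witness[where
          i = "\<lambda>b. transpose_mat G' * b * transpose_mat H'" and j = "\<lambda>b. transpose_mat G * b * transpose_mat H"])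
      (use equiv[OF assms(2,3)] equiv[OF inv] pairing in auto)
qed

lemma smult_last_unit_scalar_prod:
  assumes "w \<in> carrier_vec (Suc n)"
  shows "(p \<cdot>\<^sub>v unit_vec (Suc n) n) \<bullet> w = p * (w $ n :: 'a::comm_semiring_1)"
  using assms by (simp add: scalar_prod_def)

section \<open>Orthogonality of additive characters\<close>

locale additive_char =
  fixes \<psi> :: "'a::{field, finite} \<Rightarrow> complex" and q :: complex
  assumes nontrivial: "nontrivial_additive_character \<psi>"
    and q_def: "q = of_nat (card (UNIV :: 'a set))"
begin

sublocale non_root_of_unity q
proof
  show "q \<noteq> 0" unfolding q_def using CARD_field_gt_1[where 'a = 'a] by simp
  show "q ^ k \<noteq> 1" if "0 < k" for k
  proof
    assume "q ^ k = 1"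
    then have "card (UNIV :: 'a set) ^ k = 1"
      unfolding q_def by (metis of_nat_1 of_nat_eq_iff of_nat_power)
    then show False using CARD_field_gt_1[where 'a = 'a] that by simp
  qed
qed

lemma char_add: "\<psi> (x + y) = \<psi> x * \<psi> y"
  using nontrivial by (simp add: nontrivial_additive_character_def additive_character_def)

lemma char_0 [simp]: "\<psi> 0 = 1"
proof -
  have "cmod (\<psi> 0) = 1"
    using nontrivial by (simp add: nontrivial_additive_character_def additive_character_def)
  then have "\<psi> 0 \<noteq> 0" by auto
  moreover have "\<psi> 0 * \<psi> 0 = \<psi> 0 * 1"
    using char_add[of 0 0] by simp
  ultimately show ?thesis by (simp only: mult_cancel_left) simp
qed

text \<open>If c is not orthogonal to W, translation by a suitable v in W permutes W but multiplies
  the sum by a number other than 1, so the sum is zero.\<close>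

lemma sum_char_subspace:
  assumes W: "W \<subseteq> carrier_vec n" and add: "\<And>u v. u \<in> W \<Longrightarrow> v \<in> W \<Longrightarrow> u + v \<in> W"
    and smult: "\<And>k v. v \<in> W \<Longrightarrow> k \<cdot>\<^sub>v v \<in> W" and c: "c \<in> carrier_vec n"
  shows "(\<Sum>w\<in>W. \<psi> (c \<bullet> w)) = (if \<forall>w\<in>W. c \<bullet> w = 0 then of_nat (card W) else 0)"
proof (cases "\<forall>w\<in>W. c \<bullet> w = 0")
  case True
  then show ?thesis by simp
next
  case False
  then obtain w where w: "w \<in> W" "c \<bullet> w \<noteq> 0" by blast
  obtain x where x: "\<psi> x \<noteq> 1"
    using nontrivial by (auto simp: nontrivial_additive_character_def)
  \<comment> \<open>Scaled so that c \<bullet> v = x, a point where the character is not 1.\<close>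
  define v where "v = (x / (c \<bullet> w)) \<cdot>\<^sub>v w"
  have v: "v \<in> W" "v \<in> carrier_vec n" "c \<bullet> v = x"
    using w W c smult[OF w(1)] by (auto simp: v_def)
  have fin: "finite W"
    using W finite_carrier_vec by (rule finite_subset)
  have inj: "inj_on (\<lambda>u. u + v) W"
  proof (rule inj_onI)
    fix s t assume st: "s \<in> W" "t \<in> W" "s + v = t + v"
    then have c: "s \<in> carrier_vec n" "t \<in> carrier_vec n"
      using W by auto
    show "s = t"
    proof (rule eq_vecI)
      fix i assume "i < dim_vec t"
      then show "s $ i = t $ i"
        using arg_cong[OF st(3), of "\<lambda>u. u $ i"] c v(2) by simp
    qed (use c in auto)
  qed
  have image: "(\<lambda>u. u + v) ` W = W"
    using fin _ inj by (rule endo_inj_surj) (auto intro: add v)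
  have "(\<Sum>u\<in>W. \<psi> (c \<bullet> u)) = (\<Sum>u\<in>(\<lambda>u. u + v) ` W. \<psi> (c \<bullet> u))"
    by (simp only: image)
  also have "\<dots> = (\<Sum>u\<in>W. \<psi> (c \<bullet> (u + v)))"
    by (simp add: sum.reindex[OF inj])
  also have "\<dots> = (\<Sum>u\<in>W. \<psi> (c \<bullet> u)) * \<psi> x"
    unfolding sum_distrib_right
    by (intro sum.cong refl) (use W v c in \<open>auto simp: scalar_prod_add_distrib[of _ n] char_add\<close>)
  finally show ?thesis
    using x False by auto
qed

lemma sum_char_mat_range:
  assumes "b \<in> carrier_mat n m" "c \<in> carrier_vec n"
  shows "(\<Sum>w\<in>mat_range b. \<psi> (c \<bullet> w)) =
    (if \<forall>w\<in>mat_range b. c \<bullet> w = 0 then q ^ vec_space.rank n b else 0)"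
  using assms
  by (subst sum_char_subspace[OF mat_range_carrier[OF assms(1)]])
    (auto simp: mat_range_add mat_range_smult card_mat_range q_def)

section \<open>Recurrences for the character sums\<close>

lemma rank_sum_0_right:
  assumes "a \<in> carrier_mat n m"
  shows "rank_sum \<psi> n m a 0 = 1"
proof -
  have "{b \<in> carrier_mat n m. vec_space.rank n b = 0} = {0\<^sub>m n m :: 'a mat}"
    by (auto simp: mat_rank_eq_0_iff vec_space.rank_0I)
  then show ?thesis
    using assms by (simp add: rank_sum_def mat_pairing_zero)
qed

text \<open>For fixed b the last column d yields rank r + 1 in two ways: b has that rank and d lies
  in its column space, or b has rank r and d lies outside. The sum over the complement is written as
  a difference of sums over subspaces, ready for orthogonality.\<close>

lemma rank_sum_split_last_col:
  assumes a: "a \<in> carrier_mat n m" and c: "c \<in> carrier_vec n"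
  shows "rank_sum \<psi> n (Suc m) (snoc_col a c) (Suc r) =
    (\<Sum>b\<in>carrier_mat n m. \<psi> (mat_pairing a b) *
      (if vec_space.rank n b = Suc r then \<Sum>d\<in>mat_range b. \<psi> (c \<bullet> d)
       else if vec_space.rank n b = r then (\<Sum>d\<in>carrier_vec n. \<psi> (c \<bullet> d)) - (\<Sum>d\<in>mat_range b. \<psi> (c \<bullet> d))
       else 0))"
proof -
  define D where "D b = {d \<in> carrier_vec n. vec_space.rank n (snoc_col b d) = Suc r}" for b :: "'a mat"
  have "rank_sum \<psi> n (Suc m) (snoc_col a c) (Suc r) =
      (\<Sum>(b, d)\<in>Sigma (carrier_mat n m) D. \<psi> (mat_pairing (snoc_col a c) (snoc_col b d)))"
  proof -
    have "inj_on (\<lambda>(b, d). snoc_col b d) (Sigma (carrier_mat n m) D)"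
      by (auto simp: inj_on_def D_def dest: snoc_col_inject)
    moreover have "{b \<in> carrier_mat n (Suc m). vec_space.rank n b = Suc r} =
        (\<lambda>(b, d). snoc_col b d) ` Sigma (carrier_mat n m) D"
      by (auto simp: D_def elim!: snoc_col_cases)
    ultimately show ?thesis
      unfolding rank_sum_def by (simp add: sum.reindex case_prod_beta')
  qed
  also have "\<dots> = (\<Sum>b\<in>carrier_mat n m. \<Sum>d\<in>D b. \<psi> (mat_pairing (snoc_col a c) (snoc_col b d)))"
    by (rule sum.Sigma[symmetric]) (auto simp: finite_carrier_mat D_def finite_carrier_vec)
  also have "\<dots> = (\<Sum>b\<in>carrier_mat n m. \<psi> (mat_pairing a b) * (\<Sum>d\<in>D b. \<psi> (c \<bullet> d)))"
    unfolding sum_distrib_left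
    by (intro sum.cong refl) (use a c in \<open>auto simp: mat_pairing_snoc_col char_add D_def\<close>)
  also have "\<dots> = (\<Sum>b\<in>carrier_mat n m. \<psi> (mat_pairing a b) *
      (if vec_space.rank n b = Suc r then \<Sum>d\<in>mat_range b. \<psi> (c \<bullet> d)
       else if vec_space.rank n b = r then (\<Sum>d\<in>carrier_vec n. \<psi> (c \<bullet> d)) - (\<Sum>d\<in>mat_range b. \<psi> (c \<bullet> d))
       else 0))"
  proof (intro sum.cong refl arg_cong2[where f = "(*)"])
    fix b :: "'a mat" assume b: "b \<in> carrier_mat n m"
    have D: "D b = (if vec_space.rank n b = Suc r then mat_range b
       else if vec_space.rank n b = r then carrier_vec n - mat_range b else {})"
      using b mat_range_carrier[OF b] by (auto simp: D_def mat_rank_snoc_col split: if_splits)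
    show "(\<Sum>d\<in>D b. \<psi> (c \<bullet> d)) = (if vec_space.rank n b = Suc r then \<Sum>d\<in>mat_range b. \<psi> (c \<bullet> d)
       else if vec_space.rank n b = r then (\<Sum>d\<in>carrier_vec n. \<psi> (c \<bullet> d)) - (\<Sum>d\<in>mat_range b. \<psi> (c \<bullet> d))
       else 0)"
      unfolding D using mat_range_carrier[OF b] by (simp add: sum_diff finite_carrier_vec)
  qed
  finally show ?thesis .
qed

lemma rank_sum_combination:
  "(\<Sum>b\<in>carrier_mat n m. \<psi> (mat_pairing a b) *
      (if vec_space.rank n b = Suc r then x else if vec_space.rank n b = r then y else 0)) =
    x * rank_sum \<psi> n m a (Suc r) + y * rank_sum \<psi> n m a r"
proof -
  have *: "rank_sum \<psi> n m a k = (\<Sum>b\<in>carrier_mat n m. if vec_space.rank n b = k then \<psi> (mat_pairing a b) else 0)" for k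
    unfolding rank_sum_def by (rule sum.inter_filter) (rule finite_carrier_mat)
  show ?thesis
    unfolding * sum_distrib_left sum.distrib[symmetric] by (intro sum.cong refl) auto
qed

lemma card_carrier_vec: "card (carrier_vec n :: 'a vec set) = card (UNIV :: 'a set) ^ n"
proof -
  have "vec_space.rank n (1\<^sub>m n :: 'a mat) = n"
    by (subst vec_space.det_rank_iff[symmetric]) auto
  moreover have "mat_range (1\<^sub>m n :: 'a mat) = carrier_vec n"
    by (auto simp: mat_range_def image_iff intro: bexI[of _ "_ :: 'a vec"])
  ultimately show ?thesis
    using card_mat_range[of "1\<^sub>m n :: 'a mat" n n] by simp
qed

text \<open>With c = 0 every inner sum merely counts vectors, which yields the recurrence of
  \<open>rank_count_Suc_right\<close>.\<close>

lemma rank_sum_zero_last_col: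
  assumes a: "a \<in> carrier_mat n m"
  shows "rank_sum \<psi> n (Suc m) (snoc_col a (0\<^sub>v n)) (Suc r) =
    q ^ Suc r * rank_sum \<psi> n m a (Suc r) + (q ^ n - q ^ r) * rank_sum \<psi> n m a r"
proof -
  have "(\<Sum>d\<in>W. \<psi> (0\<^sub>v n \<bullet> d)) = of_nat (card W)" if "W \<subseteq> carrier_vec n" for W
    using that by (simp add: subset_iff cong: sum.cong_simp)
  then have "(\<Sum>d\<in>mat_range b. \<psi> (0\<^sub>v n \<bullet> d)) = q ^ vec_space.rank n b" if "b \<in> carrier_mat n m" for b
    using mat_range_carrier[OF that] card_mat_range[OF that] by (simp add: q_def)
  moreover have "(\<Sum>d\<in>carrier_vec n. \<psi> (0\<^sub>v n \<bullet> d)) = q ^ n"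
    by (simp add: card_carrier_vec q_def cong: sum.cong_simp)
  ultimately show ?thesis
    unfolding rank_sum_split_last_col[OF a zero_carrier_vec] rank_sum_combination[symmetric]
    by (intro sum.cong refl) auto
qed

text \<open>The character d \<mapsto> \<psi>(p d_n) is non-trivial on the full space, so the total
  sum is 0. On the column space of b it is trivial exactly when the last row of b is zero, so only
  matrices \<open>snoc_zero_row b'\<close> contribute.\<close>

lemma rank_sum_corner_mat:
  assumes a: "a \<in> carrier_mat n m" and "p \<noteq> 0"
  shows "rank_sum \<psi> (Suc n) (Suc m) (corner_mat a p) (Suc r) =
    q ^ Suc r * rank_sum \<psi> n m a (Suc r) - q ^ r * rank_sum \<psi> n m a r"
proof -
  define c where "c = p \<cdot>\<^sub>v unit_vec (Suc n) n"
  have c: "c \<in> carrier_vec (Suc n)" by (simp add: c_def)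
  have c_prod: "c \<bullet> w = p * w $ n" if "w \<in> carrier_vec (Suc n)" for w
    using that unfolding c_def by (rule smult_last_unit_scalar_prod)
  define Z where "Z = snoc_zero_row ` (carrier_mat n m :: 'a mat set)"
  have total: "(\<Sum>d\<in>carrier_vec (Suc n). \<psi> (c \<bullet> d)) = 0"
  proof (subst sum_char_subspace[of _ "Suc n"])
    have "c \<bullet> unit_vec (Suc n) n \<noteq> 0"
      using \<open>p \<noteq> 0\<close> by (simp add: c_def)
    then have "\<not> (\<forall>w\<in>carrier_vec (Suc n). c \<bullet> w = 0)"
      using unit_vec_carrier by blast
    then show "(if \<forall>w\<in>carrier_vec (Suc n). c \<bullet> w = 0
        then of_nat (card (carrier_vec (Suc n) :: 'a vec set)) else 0) = (0 :: complex)"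
      by (simp only: if_False)
  qed (use c in auto)
  have orth: "(\<forall>w\<in>mat_range b. c \<bullet> w = 0) \<longleftrightarrow> b \<in> Z" if b: "b \<in> carrier_mat (Suc n) m" for b
  proof
    assume *: "\<forall>w\<in>mat_range b. c \<bullet> w = 0"
    have "b $$ (n, j) = 0" if "j < m" for j
    proof -
      \<comment> \<open>Testing orthogonality on column j isolates p times the last entry of that
        column.\<close>
      have "c \<bullet> (b *\<^sub>v unit_vec m j) = 0"
        using * b by (auto simp: mat_range_def)
      then have "(b *\<^sub>v unit_vec m j) $ n = 0"
        using b \<open>p \<noteq> 0\<close> by (subst (asm) c_prod) auto
      then show ?thesis
        using b that by simp
    qed
    then have "b = snoc_zero_row (mat n m (\<lambda>ij. b $$ ij))"
      using b by (intro eq_matI) (auto simp: snoc_zero_row_def less_Suc_eq)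
    then show "b \<in> Z" unfolding Z_def by (rule image_eqI) simp
  next
    assume "b \<in> Z"
    then obtain b' where b': "b = snoc_zero_row b'" "b' \<in> carrier_mat n m"
      by (auto simp: Z_def)
    have "c \<bullet> (b *\<^sub>v x) = 0" if "x \<in> carrier_vec m" for x
    proof -
      have "(b *\<^sub>v x) $ n = (\<Sum>j<m. b $$ (n, j) * x $ j)"
        using b that by (intro index_mult_mat_vec_sum) auto
      also have "\<dots> = 0"
        using b' by (simp add: snoc_zero_row_def)
      finally show ?thesis
        using b that by (subst c_prod) auto
    qed
    then show "\<forall>w\<in>mat_range b. c \<bullet> w = 0"
      using b by (auto simp: mat_range_def)
  qed
  have inj: "inj_on snoc_zero_row (carrier_mat n m :: 'a mat set)"
  proof (rule inj_onI)
    fix x y :: "'a mat"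
    assume xy: "x \<in> carrier_mat n m" "y \<in> carrier_mat n m" "snoc_zero_row x = snoc_zero_row y"
    show "x = y"
    proof (rule eq_matI)
      fix i j assume "i < dim_row y" "j < dim_col y"
      then have "x $$ (i, j) = snoc_zero_row x $$ (i, j)" "y $$ (i, j) = snoc_zero_row y $$ (i, j)"
        using xy(1,2) by (auto simp: snoc_zero_row_def)
      then show "x $$ (i, j) = y $$ (i, j)" using xy(3) by simp
    qed (use xy in auto)
  qed
  \<comment> \<open>The inner sum for b in \<open>Z\<close> of rank k: the column space itself gives
    q^(r+1) for k = r + 1, and its complement gives 0 - q^r for k = r.\<close>
  define f where "f k = (if k = Suc r then q ^ Suc r else if k = r then - (q ^ r) else 0)" for k
  have "rank_sum \<psi> (Suc n) (Suc m) (corner_mat a p) (Suc r) =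
      (\<Sum>b\<in>carrier_mat (Suc n) m. \<psi> (mat_pairing (snoc_zero_row a) b) *
        (if b \<in> Z then f (vec_space.rank (Suc n) b) else 0))"
  proof -
    have "corner_mat a p = snoc_col (snoc_zero_row a) c"
      using a by (simp add: corner_mat_def c_def)
    moreover have "snoc_zero_row a \<in> carrier_mat (Suc n) m"
      using a by simp
    ultimately show ?thesis
      using c by (simp only: rank_sum_split_last_col)
        (intro sum.cong refl, simp add: sum_char_mat_range total orth f_def)
  qed
  also have "\<dots> = (\<Sum>b\<in>Z. \<psi> (mat_pairing (snoc_zero_row a) b) * f (vec_space.rank (Suc n) b))"
    by (rule sum.mono_neutral_cong_right) (auto simp: Z_def finite_carrier_mat)
  also have "\<dots> = (\<Sum>b\<in>carrier_mat n m. \<psi> (mat_pairing a b) * f (vec_space.rank n b))"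
    unfolding Z_def using a
    by (subst sum.reindex[OF inj]) (auto simp: mat_pairing_snoc_zero_row mat_rank_snoc_zero_row intro!: sum.cong)
  also have "\<dots> = q ^ Suc r * rank_sum \<psi> n m a (Suc r) - q ^ r * rank_sum \<psi> n m a r"
    unfolding f_def rank_sum_combination by simp
  finally show ?thesis .
qed

lemma rank_sum_zero_mat: "rank_sum \<psi> n m (0\<^sub>m n m) r = rank_count q n m r"
proof (induction m arbitrary: r)
  case 0
  show ?case
  proof (cases r)
    case 0
    then show ?thesis by (simp add: rank_sum_0_right)
  next
    case (Suc k)
    \<comment> \<open>Without columns there is no positive rank; on the other side (q^0; 1/q)_(k+1)
      contains the factor 1 - 1.\<close>
    have *: "{b \<in> carrier_mat n 0. vec_space.rank n b = Suc k} = ({} :: 'a mat set)"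
      using vec_space.rank_le_nc[of _ n 0] by fastforce
    then show ?thesis
      unfolding Suc rank_sum_def * by (simp add: rank_count_def qpoch_Suc_shift)
  qed
next
  case (Suc m)
  show ?case
  proof (cases r)
    case 0
    then show ?thesis by (simp add: rank_sum_0_right)
  next
    case (Suc k)
    have "0\<^sub>m n (Suc m) = snoc_col (0\<^sub>m n m) (0\<^sub>v n :: 'a vec)"
      by (intro eq_matI) (auto simp: snoc_col_def)
    then show ?thesis
      by (simp add: Suc rank_sum_zero_last_col Suc.IH rank_count_Suc_right)
  qed
qed

text \<open>Induction on the rank of a, removing one corner entry at a time. The bounds on the rank
  are proved along with the formula because \<open>rank_char_sum_recurrence\<close> requires
  them.\<close>

lemma rank_sum_eq:
  assumes "a \<in> carrier_mat n m"
  shows "rank_sum \<psi> n m a r = rank_char_sum q n m (vec_space.rank n a) r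
    \<and> vec_space.rank n a \<le> n \<and> vec_space.rank n a \<le> m"
  using assms
proof (induction "vec_space.rank n a" arbitrary: n m a r)
  case 0
  then have "a = 0\<^sub>m n m"
    using mat_rank_eq_0_iff by metis
  then show ?case
    using 0 by (simp add: rank_sum_zero_mat rank_char_sum_0_left)
next
  case (Suc s)
  have "a \<noteq> 0\<^sub>m n m"
    using mat_rank_eq_0_iff[OF Suc.prems] Suc.hyps(2)[symmetric] by simp
  with Suc.prems obtain n' m' G G' H H' b p where nm: "n = Suc n'" "m = Suc m'"
    and GH: "inverse_mats n G G'" "inverse_mats m H H'"
    and b: "b \<in> carrier_mat n' m'" "p \<noteq> 0" and a: "a = G * corner_mat b p * H"
    by (rule corner_mat_decomposition)
  have corner: "corner_mat b p \<in> carrier_mat n m"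
    using b by (simp add: nm)
  have "vec_space.rank n a = vec_space.rank n (corner_mat b p)"
    using corner GH unfolding a inverse_mats_def
    by (subst mat_rank_mult_right[of _ n m H H'])
      (auto simp: mat_rank_mult_left[of _ n m G G'])
  then have s: "vec_space.rank n a = Suc s" "s = vec_space.rank n' b"
    using Suc.hyps(2) b unfolding nm by (auto simp: mat_rank_corner_mat)
  have IH: "rank_sum \<psi> n' m' b r = rank_char_sum q n' m' s r" "s \<le> n'" "s \<le> m'" for r
    using Suc.hyps(1)[OF s(2) b(1), of r] s(2) by auto
  have "rank_sum \<psi> n m a r = rank_sum \<psi> n m (corner_mat b p) r"
    unfolding a using corner GH by (rule rank_sum_equiv)
  also have "\<dots> = rank_char_sum q n m (Suc s) r"
  proof (cases r)
    case 0
    then show ?thesis using corner by (simp add: rank_sum_0_right)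
  next
    case (Suc k)
    show ?thesis
      unfolding Suc nm rank_sum_corner_mat[OF b] IH(1) rank_char_sum_recurrence[OF IH(2,3)] ..
  qed
  finally show ?case
    unfolding s(1) using IH(2,3) by (simp add: nm)
qed

end

theorem proposition1p0p4:
  fixes \<theta> :: "'a::{field, finite} \<Rightarrow> complex"
    and n m s r :: nat
    and q :: complex
  assumes "q = of_nat (card (UNIV :: 'a set))"
    and "n \<le> m"
    and "nontrivial_additive_character \<theta>"
    and "s \<le> n" and "r \<le> n"
  shows "canonical_matrix \<theta> n m s r =
    (- 1) ^ r * q ^ (r choose 2) * qpoch (q ^ m) (inverse q) r * gauss_poly q n r *
    aff_q_krawtchouk s r (q powi (- int m)) n q"
proof -
  \<comment> \<open>The conjugation in the canonical matrix is absorbed into the character.\<close>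
  have "nontrivial_additive_character (\<lambda>x. cnj (\<theta> x))"
    using assms(3) by (auto simp: nontrivial_additive_character_def additive_character_def)
  then interpret additive_char "\<lambda>x. cnj (\<theta> x)" q
    using assms(1) by unfold_locales
  have "(\<Sum>b \<in> {b \<in> carrier_mat n m. mat_rank b = r}. cnj (\<theta> (mat_pairing a b))) = rank_char_sum q n m s r"
    if "a \<in> carrier_mat n m" "mat_rank a = s" for a
  proof -
    have "{b \<in> carrier_mat n m. mat_rank b = r} = {b \<in> carrier_mat n m. vec_space.rank n (b :: 'a mat) = r}"
      by auto
    then show ?thesis
      using rank_sum_eq[OF that(1), of r] that unfolding rank_sum_def by simp
  qed
  \<comment> \<open>The common value is unique only if some matrix has rank s, which s \<le> n \<le>
    m guarantees.\<close>
  moreover obtain a :: "'a mat" where "a \<in> carrier_mat n m" "mat_rank a = s"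
    using exists_mat_of_rank[of s n m, where 'a = 'a] assms(2,4) by auto
  ultimately have "canonical_matrix \<theta> n m s r = rank_char_sum q n m s r"
    unfolding canonical_matrix_def by (intro the_equality) auto
  then show ?thesis
    by (simp add: rank_char_sum_def rank_count_def)
qed

end
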